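(* Let $U$ be an $n\times n$ unitary and let $G$ be an abelian group of $n\times n$ permutation matrices such that for each $P\in G$ there is a diagonal matrix $D_P$ (diagonal entries $d_{P,0},\dots,d_{P,n-1}$) with $UP=D_PU$. Let $\mathcal S_G$ be the set of tuples $s=(s_0,\dots,s_{n-1})$ of nonnegative integers with $\sum s_i=n$ and $\prod_i d_{P,i}^{s_i}=1$ for all $P\in G$. Let $|\eta\rangle$ be a pure state of $n$ photons in $n$ modes (with internal degrees of freedom), and let $|\eta_+\rangle$ be the normalization of its orthogonal projection onto the joint $+1$-eigenspace of all $\hat P$, $P\in G$ (assumed nonzero). Then: (1) For every $s\in\mathcal S_G$, $\Pi_s\hat U|\eta\rangle=\langle\eta_+|\eta\rangle\,\Pi_s\hat U|\eta_+\rangle$. (2) $h_n(|\eta\rangle\langle\eta|)=|\langle\eta_+|\eta\rangle|^2\,h_n(|\eta_+\rangle\langle\eta_+|)$ and (whenever these are defined, i.e. the heralding rates are nonzero) $e_n(|\eta\rangle\langle\eta|)=e_n(|\eta_+\rangle\langle\eta_+|)$. (3) Suppose moreover that either $U=H_n=H^{\otimes r}$ with $n=2^r\ge4$ and $G=\{X^{i_1}\otimes\cdots\otimes X^{i_r}:i_j\in\{0,1\}\}$, or $U=F_n$ with $n\ge3$ a prime power and $G$ the cyclic group generated by the cyclic permutation matrix $P$ with $PE_j=E_{j+1\bmod n}$ on standard basis vectors. Then $$h_n(|\eta_+\rangle\langle\eta_+|)=\big\|(\langle1|\otimes I)\hat U|\eta_+\rangle\big\|^2,$$ the probability that exactly one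 photon is found in mode $0$ after applying $\hat U$ to $|\eta_+\rangle$.
   Context: Each photon has external mode in $\{0,\dots,n-1\}$ and internal state in a Hilbert space with fixed orthonormal basis $\{\xi_0,\xi_1,\dots\}$; the $n$-photon space is $(\mathbb C^n\otimes\mathcal H_{\rm int})^{\otimes n}$. For an $n\times n$ matrix $T$, $\hat T=T^{\otimes n}\otimes I^{\otimes n}$ acts on the external modes of every photon (so $\hat P$ permutes modes, not photons). $\Pi_s$ is the projector onto the subspace of states with $s_j$ photons in mode $j$ for all $j$, regardless of internal state; $(\langle1|\otimes I)$ denotes projection onto states with exactly one photon in mode $0$. $H$ is the $2\times2$ Hadamard matrix, $X$ the Pauli $X$ matrix, with $\mathbb C^{2^r}=(\mathbb C^2)^{\otimes r}$ via binary expansion of mode labels; $F_n=\frac1{\sqrt n}(e^{2\pi ijk/n})_{j,k}$. Ideal patterns of $U$: $(s_0,\dots,s_{n-1})$ with $\sum s_i=n$, $s_0=1$ and $\langle s_0,\dots,s_{n-1}|\hat U|1,\dots,1\rangle\ne0$ (indistinguishable Fock states). Distillation protocol with input state $\sigma$: apply $\hat U$, measure photon numbers in modes $1,\dots,n-1$, set $s_0=n-\sum_{j\ge1}s_j$, herald success iff the pattern is ideal. $h_n(\sigma)$ is the success probability; $e_n(\sigma)$ is the conditional probability, given success, that the photon in mode $0$ has internal state $\xi_i$ for some $i\ge1$ (via projective measurement onto the normalized states $a^\dagger_{m_0}[\xi_{i_0}]\cdots a^\dagger_{m_{n-1}}[\xi_{i_{n-1}}]|\vec0\rangle$). *)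

theory Defs
  imports "HOL-Analysis.Analysis" "HOL-Library.Multiset" "HOL-Computational_Algebra.Primes"
begin

text \<open>
  Model of the n-photon space (C^n (x) H_int)^(x n).  A basis vector of the
  tensor product is a list c of length n whose k-th entry (m, i) says that
  photon k is in external mode m < n with internal basis state xi_i.
  A vector is a square-summable function from such lists to complex numbers
  (zero on lists that are not valid configurations).
  Matrices are functions nat => nat => complex, only entries < n matter.
\<close>

type_synonym config = "(nat \<times> nat) list"
type_synonym vec = "config \<Rightarrow> complex"
type_synonym mat = "nat \<Rightarrow> nat \<Rightarrow> complex"

definition valid_config :: "nat \<Rightarrow> config \<Rightarrow> bool" where
  "valid_config n c \<longleftrightarrow> length c = n \<and> (\<forall>p\<in>set c. fst p < n)"

definition in_space :: "nat \<Rightarrow> vec \<Rightarrow> bool" where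
  "in_space n \<psi> \<longleftrightarrow> (\<forall>c. \<psi> c \<noteq> 0 \<longrightarrow> valid_config n c)
      \<and> (\<lambda>c. (cmod (\<psi> c))\<^sup>2) summable_on UNIV"

definition inner_v :: "vec \<Rightarrow> vec \<Rightarrow> complex" where
  "inner_v \<phi> \<psi> = (\<Sum>\<^sub>\<infinity>c. cnj (\<phi> c) * \<psi> c)"

definition normsq_v :: "vec \<Rightarrow> real" where
  "normsq_v \<psi> = (\<Sum>\<^sub>\<infinity>c. (cmod (\<psi> c))\<^sup>2)"

definition normalize_v :: "vec \<Rightarrow> vec" where
  "normalize_v \<psi> = (\<lambda>c. \<psi> c / complex_of_real (sqrt (normsq_v \<psi>)))"

definition symmetric_v :: "vec \<Rightarrow> bool" where
  "symmetric_v \<psi> \<longleftrightarrow> (\<forall>c c'. mset c = mset c' \<longrightarrow> \<psi> c = \<psi> c')"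

text \<open>hat T = T^(x n) (x) I^(x n): T acts on the external mode of every photon.\<close>
definition lift :: "nat \<Rightarrow> mat \<Rightarrow> vec \<Rightarrow> vec" where
  "lift n T \<psi> = (\<lambda>c. if valid_config n c then
      (\<Sum>ms\<in>{ms. set ms \<subseteq> {..<n} \<and> length ms = n}.
          (\<Prod>k<n. T (fst (c ! k)) (ms ! k)) * \<psi> (zip ms (map snd c)))
    else 0)"

definition unitary_mat :: "nat \<Rightarrow> mat \<Rightarrow> bool" where
  "unitary_mat n U \<longleftrightarrow>
     (\<forall>i<n. \<forall>j<n. (\<Sum>k<n. U i k * cnj (U j k)) = (if i = j then 1 else 0)) \<and>
     (\<forall>i<n. \<forall>j<n. (\<Sum>k<n. cnj (U k i) * U k j) = (if i = j then 1 else 0))"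

definition perm_mat :: "(nat \<Rightarrow> nat) \<Rightarrow> mat" where
  "perm_mat \<sigma> i j = (if i = \<sigma> j then 1 else 0)"

text \<open>An abelian group of n x n permutation matrices, given by the
  corresponding group of permutations of {0..n-1} (sigma |-> perm_mat sigma is
  an injective homomorphism).\<close>
definition abelian_perm_group :: "nat \<Rightarrow> (nat \<Rightarrow> nat) set \<Rightarrow> bool" where
  "abelian_perm_group n G \<longleftrightarrow>
     (\<forall>\<sigma>\<in>G. \<sigma> permutes {..<n}) \<and> id \<in> G \<and>
     (\<forall>\<sigma>\<in>G. \<forall>\<tau>\<in>G. \<sigma> \<circ> \<tau> \<in> G) \<and> (\<forall>\<sigma>\<in>G. inv \<sigma> \<in> G) \<and>
     (\<forall>\<sigma>\<in>G. \<forall>\<tau>\<in>G. \<sigma> \<circ> \<tau> = \<tau> \<circ> \<sigma>)"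

definition occ :: "config \<Rightarrow> nat \<Rightarrow> nat" where
  "occ c j = length (filter (\<lambda>p. fst p = j) c)"

definition proj_occ :: "nat \<Rightarrow> (nat \<Rightarrow> nat) \<Rightarrow> vec \<Rightarrow> vec" where
  "proj_occ n s \<psi> = (\<lambda>c. if \<forall>j<n. occ c j = s j then \<psi> c else 0)"

definition proj_one0 :: "vec \<Rightarrow> vec" where
  "proj_one0 \<psi> = (\<lambda>c. if occ c 0 = 1 then \<psi> c else 0)"

text \<open>Normalized Fock state |s> of indistinguishable photons (internal state xi_0).\<close>
definition fock_state :: "nat \<Rightarrow> (nat \<Rightarrow> nat) \<Rightarrow> vec" where
  "fock_state n s = (\<lambda>c. if valid_config n c \<and> (\<forall>p\<in>set c. snd p = 0) \<and> (\<forall>j<n. occ c j = s j)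
      then complex_of_real (sqrt ((\<Prod>j<n. fact (s j)) / fact n)) else 0)"

definition patterns :: "nat \<Rightarrow> (nat \<Rightarrow> nat) set" where
  "patterns n = {s. (\<forall>i\<ge>n. s i = 0) \<and> (\<Sum>i<n. s i) = n}"

definition ideal_pattern :: "nat \<Rightarrow> mat \<Rightarrow> (nat \<Rightarrow> nat) \<Rightarrow> bool" where
  "ideal_pattern n U s \<longleftrightarrow> (\<Sum>i<n. s i) = n \<and> s 0 = 1 \<and>
     inner_v (fock_state n s) (lift n U (fock_state n (\<lambda>_. 1))) \<noteq> 0"

definition herald :: "nat \<Rightarrow> mat \<Rightarrow> vec \<Rightarrow> real" where
  "herald n U \<psi> = (\<Sum>s\<in>{s\<in>patterns n. ideal_pattern n U s}. normsq_v (proj_occ n s (lift n U \<psi>)))"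

text \<open>Normalized symmetric basis states a^dag_{m_0}[xi_{i_0}] ... |0>, indexed by the
  multiset M of (mode, internal index) pairs.\<close>
definition fock_basis :: "nat \<Rightarrow> (nat \<times> nat) multiset \<Rightarrow> vec" where
  "fock_basis n M = (\<lambda>c. if valid_config n c \<and> mset c = M
      then complex_of_real (sqrt ((\<Prod>x\<in>set_mset M. fact (count M x)) / fact n)) else 0)"

definition mocc :: "(nat \<times> nat) multiset \<Rightarrow> nat \<Rightarrow> nat" where
  "mocc M j = size (filter_mset (\<lambda>p. fst p = j) M)"

definition error_outcomes :: "nat \<Rightarrow> mat \<Rightarrow> (nat \<times> nat) multiset set" where
  "error_outcomes n U = {M. size M = n \<and> (\<forall>p\<in>#M. fst p < n) \<and>
      ideal_pattern n U (\<lambda>j. if j < n then mocc M j else 0) \<and> (\<exists>i\<ge>1. (0, i) \<in># M)}"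

definition error_rate :: "nat \<Rightarrow> mat \<Rightarrow> vec \<Rightarrow> real" where
  "error_rate n U \<psi> =
     (\<Sum>\<^sub>\<infinity>M\<in>error_outcomes n U. (cmod (inner_v (fock_basis n M) (lift n U \<psi>)))\<^sup>2) / herald n U \<psi>"

definition in_eig :: "nat \<Rightarrow> (nat \<Rightarrow> nat) set \<Rightarrow> vec \<Rightarrow> bool" where
  "in_eig n G w \<longleftrightarrow> in_space n w \<and> (\<forall>\<sigma>\<in>G. lift n (perm_mat \<sigma>) w = w)"

definition is_eig_projection :: "nat \<Rightarrow> (nat \<Rightarrow> nat) set \<Rightarrow> vec \<Rightarrow> vec \<Rightarrow> bool" where
  "is_eig_projection n G \<eta> \<phi> \<longleftrightarrow> in_eig n G \<phi> \<and>
     (\<forall>w. in_eig n G w \<longrightarrow> inner_v w (\<lambda>c. \<eta> c - \<phi> c) = 0)"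

text \<open>H^(x r) with binary expansion of mode labels.\<close>
definition hadamard_mat :: "nat \<Rightarrow> mat" where
  "hadamard_mat r j k = complex_of_real (1 / sqrt (2 ^ r)) *
     (\<Prod>t<r. if odd (j div 2 ^ t) \<and> odd (k div 2 ^ t) then -1 else 1)"

text \<open>{X^i_1 (x) ... (x) X^i_r}: flipping the bits of the mode label given by a.\<close>
definition xor_group :: "nat \<Rightarrow> (nat \<Rightarrow> nat) set" where
  "xor_group r = {(\<lambda>j. if j < 2 ^ r then xor j a else j) | a. a < 2 ^ r}"

definition fourier_mat :: "nat \<Rightarrow> mat" where
  "fourier_mat n j k = exp (2 * complex_of_real pi * \<i> * of_nat j * of_nat k / of_nat n)
     / complex_of_real (sqrt (real n))"

definition cyc :: "nat \<Rightarrow> nat \<Rightarrow> nat" where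
  "cyc n j = (if j < n then Suc j mod n else j)"

definition cyc_group :: "nat \<Rightarrow> (nat \<Rightarrow> nat) set" where
  "cyc_group n = {cyc n ^^ k | k. True}"

end

(*
Every coordinate c of lift n U eta is an inner product of eta with U^dagger applied to the basis
vector of c. From U P = D_P U, that vector is fixed by every P exactly when the pattern of c satisfies
prod_i d_{P,i}^{s_i} = 1, so on those coordinates eta may be replaced by its projection. The same
computation, applied to the invariant input |1,...,1>, shows that ideal patterns satisfy this condition.

For the last claim one needs the converse: if n = p^k and the pattern s satisfies the condition, the
amplitude <s|U|1,...,1> does not vanish. Up to a factor it is the permanent of a matrix K whose i-th
column is a character x_i of G (G is simply transitive on the modes), and the product of all x_i is
trivial. Summing over injections and sorting by the block B that contains a fixed point gives
E(T) = sum over B of (-1)^(|B|-1) (|B|-1)! n [x_B trivial] E(T - B). As n (a-1)! (b-1)! has larger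
p-adic valuation than (a+b-1)! whenever a + b <= n, the single block B = T dominates p-adically, and the
permanent has the valuation of n (n-1)!, hence is nonzero.
*)
theory Submission
  imports Defs
begin

section \<open>Permanents of character matrices\<close>

text \<open>The permanent of \<open>K\<close> when \<open>A\<close> and \<open>T\<close> are finite of the same size.\<close>
definition inj_sum :: "('c \<Rightarrow> 'i \<Rightarrow> 'a::comm_ring_1) \<Rightarrow> 'c set \<Rightarrow> 'i set \<Rightarrow> 'a" where
  "inj_sum K A T = (\<Sum>f\<in>{f \<in> T \<rightarrow>\<^sub>E A. inj_on f T}. \<Prod>i\<in>T. K (f i) i)"

lemma inj_sum_empty [simp]: "inj_sum K A {} = 1"
  by (simp add: inj_sum_def)

lemma finite_injective_PiE:
  assumes "finite T" "finite A"
  shows "finite {f \<in> T \<rightarrow>\<^sub>E A. inj_on f T}"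
  using finite_PiE[of T "\<lambda>_. A"] assms by simp

text \<open>Expansion along the index \<open>x\<close>: once \<open>x\<close> has received the value
  \<open>c\<close>, what remains is an injection of \<open>T\<close> into
  \<open>A - {c}\<close>.\<close>

lemma inj_sum_insert:
  assumes "finite A" "finite T" "x \<notin> T"
  shows "inj_sum K A (insert x T) = (\<Sum>c\<in>A. K c x * inj_sum K (A - {c}) T)"
proof -
  have "(\<Sum>c\<in>A. K c x * inj_sum K (A - {c}) T) =
      (\<Sum>(c, g)\<in>(SIGMA c:A. {g \<in> T \<rightarrow>\<^sub>E A - {c}. inj_on g T}). K c x * (\<Prod>i\<in>T. K (g i) i))"
    unfolding inj_sum_def sum_distrib_left
    by (rule sum.Sigma) (use assms in \<open>auto simp: finite_injective_PiE\<close>)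
  also have "\<dots> = inj_sum K A (insert x T)"
    unfolding inj_sum_def
  proof (rule sum.reindex_bij_witness[where i="\<lambda>f. (f x, f(x := undefined))" and j="\<lambda>(c, g). g(x := c)"], goal_cases)
    case (1 a)
    then show ?case using \<open>x \<notin> T\<close> by (auto simp: fun_eq_iff PiE_def extensional_def)
  next
    case (2 a)
    obtain c g where cg: "a = (c, g)" "c \<in> A" "g \<in> T \<rightarrow>\<^sub>E A - {c}" "inj_on g T"
      using 2 by auto
    then have "inj_on (g(x := c)) (insert x T)"
      using \<open>x \<notin> T\<close> by (auto simp: PiE_iff inj_on_def)
    then show ?case using cg by (auto simp: PiE_iff extensional_def)
  next
    case (3 b)
    then show ?case by auto
  next
    case (4 b)
    then show ?case using \<open>x \<notin> T\<close>
      by (auto simp: PiE_iff inj_on_def extensional_def)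
  next
    case (5 a)
    then show ?case using assms by (auto simp: prod.insert intro!: prod.cong arg_cong2[where f="(*)"])
  qed
  finally show ?thesis by simp
qed

text \<open>An injection into \<open>A\<close> either avoids \<open>c\<close> or attains it at exactly one point.\<close>
lemma inj_sum_remove_value:
  assumes "finite T" "finite A" "c \<in> A"
  shows "inj_sum K A T = inj_sum K (A - {c}) T + (\<Sum>y\<in>T. K c y * inj_sum K (A - {c}) (T - {y}))"
  using assms
proof (induction T arbitrary: A rule: finite_induct)
  case empty
  then show ?case by simp
next
  case (insert x T)
  \<comment> \<open>The induction hypothesis is used with the value \<open>b\<close> of
    \<open>x\<close> already removed from the target, hence the generalisation over
    \<open>A\<close>.\<close>
  have IH: "inj_sum K (A - {b}) T = inj_sum K (A - {c} - {b}) T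
      + (\<Sum>y\<in>T. K c y * inj_sum K (A - {c} - {b}) (T - {y}))" if "b \<in> A - {c}" for b
  proof -
    have "A - {b} - {c} = A - {c} - {b}" by blast
    then show ?thesis
      using insert.IH[of "A - {b}"] insert.prems that by auto
  qed
  have swap: "insert x T - {y} = insert x (T - {y})" if "y \<in> T" for y
    using that insert.hyps by auto
  have "inj_sum K A (insert x T) = K c x * inj_sum K (A - {c}) T + (\<Sum>b\<in>A - {c}. K b x * inj_sum K (A - {b}) T)"
    using insert by (simp add: inj_sum_insert sum.remove[of A c])
  also have "(\<Sum>b\<in>A - {c}. K b x * inj_sum K (A - {b}) T) =
      (\<Sum>b\<in>A - {c}. K b x * inj_sum K (A - {c} - {b}) T)
      + (\<Sum>b\<in>A - {c}. \<Sum>y\<in>T. K c y * (K b x * inj_sum K (A - {c} - {b}) (T - {y})))"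
    by (simp add: IH distrib_left sum.distrib sum_distrib_left mult.left_commute)
  also have "\<dots> = inj_sum K (A - {c}) (insert x T)
      + (\<Sum>y\<in>T. K c y * inj_sum K (A - {c}) (insert x (T - {y})))"
    using insert by (subst sum.swap) (simp add: inj_sum_insert sum_distrib_left)
  finally show ?case
    using insert by (simp add: swap algebra_simps)
qed

text \<open>Double counting of the pairs \<open>(D, y)\<close> with \<open>y \<in> D\<close>: each
  \<open>D\<close> arises as \<open>insert y C\<close> once for each of its elements.\<close>

lemma sum_subset_element:
  fixes F :: "'i set \<Rightarrow> 'a::comm_ring_1"
  assumes "finite T"
  shows "(\<Sum>y\<in>T. \<Sum>C\<in>Pow (T - {y}). F (insert y C)) = (\<Sum>D\<in>Pow T. of_nat (card D) * F D)"
proof -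
  have "(\<Sum>y\<in>T. \<Sum>C\<in>Pow (T - {y}). F (insert y C)) =
      (\<Sum>(y, C)\<in>(SIGMA y:T. Pow (T - {y})). F (insert y C))"
    by (rule sum.Sigma) (use assms in auto)
  also have "\<dots> = (\<Sum>(D, y)\<in>(SIGMA D:Pow T. D). F D)"
    by (rule sum.reindex_bij_witness[where j="\<lambda>(y, C). (insert y C, y)" and i="\<lambda>(D, y). (y, D - {y})"])
      (auto simp: insert_absorb)
  also have "\<dots> = (\<Sum>D\<in>Pow T. \<Sum>y\<in>D. F D)"
    by (rule sum.Sigma[symmetric]) (use assms finite_subset in auto)
  finally show ?thesis by simp
qed

text \<open>Iterating \<open>inj_sum_remove_value\<close>, solved for its first term, strips points
  off \<open>T\<close> one by one. A set \<open>C\<close> of stripped points arises in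
  \<open>fact (card C)\<close> orders, with one sign per point.\<close>

lemma inj_sum_avoid:
  assumes "finite T" "finite A" "c \<in> A"
  shows "inj_sum K (A - {c}) T =
    (\<Sum>C\<in>Pow T. (-1) ^ card C * fact (card C) * (\<Prod>i\<in>C. K c i) * inj_sum K A (T - C))"
  using assms(1)
proof (induction T rule: finite_psubset_induct)
  case (psubset T)
  \<comment> \<open>\<open>F (insert y C)\<close> is the contribution in which \<open>y\<close> is
    stripped first and then \<open>C\<close>. It depends only on the union \<open>D\<close>, so the
    \<open>card D\<close> choices of \<open>y\<close> turn \<open>fact (card D - 1)\<close> into
    \<open>fact (card D)\<close>.\<close>
  define F where "F D = (-1) ^ (card D - 1) * fact (card D - 1) * (\<Prod>i\<in>D. K c i) * inj_sum K A (T - D)" for D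
  have "inj_sum K (A - {c}) T = inj_sum K A T - (\<Sum>y\<in>T. K c y * inj_sum K (A - {c}) (T - {y}))"
    using inj_sum_remove_value[OF psubset.hyps assms(2,3), of K] by simp
  also have "(\<Sum>y\<in>T. K c y * inj_sum K (A - {c}) (T - {y})) = (\<Sum>y\<in>T. \<Sum>C\<in>Pow (T - {y}). F (insert y C))"
  proof (rule sum.cong[OF refl])
    fix y assume y: "y \<in> T"
    have "F (insert y C) = K c y * ((-1) ^ card C * fact (card C) * (\<Prod>i\<in>C. K c i) * inj_sum K A (T - {y} - C))"
      if "C \<in> Pow (T - {y})" for C
    proof -
      have "finite C" "y \<notin> C" using that psubset.hyps finite_subset by auto
      moreover have "T - insert y C = T - {y} - C" by auto
      ultimately show ?thesis by (simp add: F_def algebra_simps)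
    qed
    then show "K c y * inj_sum K (A - {c}) (T - {y}) = (\<Sum>C\<in>Pow (T - {y}). F (insert y C))"
      using psubset.IH[of "T - {y}"] y by (subst psubset.IH) (auto simp: sum_distrib_left simp del: Pow_iff)
  qed
  also have "\<dots> = (\<Sum>D\<in>Pow T. of_nat (card D) * F D)"
    by (rule sum_subset_element) (rule psubset.hyps)
  \<comment> \<open>The empty set has weight 0 here, so the truncated \<open>card D - 1\<close> in
    \<open>F {}\<close> does no harm. Its place in the final sum is taken by the isolated term
    \<open>inj_sum K A T\<close>.\<close>
  also have "\<dots> = (\<Sum>D\<in>Pow T - {{}}. of_nat (card D) * F D)"
    by (rule sum.mono_neutral_right) (use psubset.hyps in auto)
  also have "\<dots> = - (\<Sum>D\<in>Pow T - {{}}. (-1) ^ card D * fact (card D) * (\<Prod>i\<in>D. K c i) * inj_sum K A (T - D))"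
    unfolding sum_negf[symmetric]
  proof (rule sum.cong[OF refl])
    fix D assume D: "D \<in> Pow T - {{}}"
    then have "finite D" using psubset.hyps finite_subset by auto
    with D obtain m where "card D = Suc m" by (metis DiffD2 card_0_eq insertI1 not0_implies_Suc)
    then show "of_nat (card D) * F D = - ((-1) ^ card D * fact (card D) * (\<Prod>i\<in>D. K c i) * inj_sum K A (T - D))"
      by (simp add: F_def algebra_simps)
  qed
  finally show ?case
    using psubset.hyps by (subst sum.remove[of "Pow T" "{}"]) auto
qed

text \<open>Exchanging the sums over \<open>c\<close> and \<open>C\<close> gathers the values of
  \<open>K\<close> into one sum over \<open>A\<close> for the block \<open>insert x C\<close>. If
  \<open>K c i\<close> does not depend on \<open>i\<close>, these are power sums and the formula
  becomes Newton's identity for elementary symmetric polynomials.\<close>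

lemma inj_sum_newton:
  assumes "finite T" "finite A" "x \<notin> T"
  shows "inj_sum K A (insert x T) = (\<Sum>C\<in>Pow T. (-1) ^ card C * fact (card C) *
    (\<Sum>c\<in>A. \<Prod>i\<in>insert x C. K c i) * inj_sum K A (T - C))"
proof -
  have "inj_sum K A (insert x T) = (\<Sum>c\<in>A. K c x * inj_sum K (A - {c}) T)"
    using assms by (simp add: inj_sum_insert)
  also have "\<dots> = (\<Sum>c\<in>A. \<Sum>C\<in>Pow T. K c x * ((-1) ^ card C * fact (card C) * (\<Prod>i\<in>C. K c i) * inj_sum K A (T - C)))"
    using assms by (simp add: inj_sum_avoid sum_distrib_left)
  also have "\<dots> = (\<Sum>C\<in>Pow T. \<Sum>c\<in>A. K c x * ((-1) ^ card C * fact (card C) * (\<Prod>i\<in>C. K c i) * inj_sum K A (T - C)))"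
    by (rule sum.swap)
  also have "\<dots> = (\<Sum>C\<in>Pow T. (-1) ^ card C * fact (card C) *
    (\<Sum>c\<in>A. \<Prod>i\<in>insert x C. K c i) * inj_sum K A (T - C))"
  proof (rule sum.cong[OF refl])
    fix C assume "C \<in> Pow T"
    then have "finite C" "x \<notin> C" using assms finite_subset by auto
    then show "(\<Sum>c\<in>A. K c x * ((-1) ^ card C * fact (card C) * (\<Prod>i\<in>C. K c i) * inj_sum K A (T - C))) =
      (-1) ^ card C * fact (card C) * (\<Sum>c\<in>A. \<Prod>i\<in>insert x C. K c i) * inj_sum K A (T - C)"
      by (simp add: sum_distrib_left sum_distrib_right algebra_simps)
  qed
  finally show ?thesis .
qed

section \<open>Valuations of factorials at a prime\<close>

text \<open>The entries \<open>1 / (a * (N choose a))\<close> of Leibniz's harmonic triangle satisfy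
  \<open>1/L(N, a) + 1/L(N, a+1) = 1/L(N-1, a)\<close>; hence any common multiple of \<open>1, \<dots>, n - 1\<close> is a
  multiple of their denominators.\<close>
lemma mult_binomial_dvd:
  fixes M :: nat
  assumes M: "\<And>m. 1 \<le> m \<Longrightarrow> m < n \<Longrightarrow> m dvd M"
  shows "1 \<le> a \<Longrightarrow> a \<le> N \<Longrightarrow> N < n \<Longrightarrow> a * (N choose a) dvd M"
proof (induction a arbitrary: N rule: nat_induct_at_least[of 1])
  case base
  then show ?case using M[of N] by simp
next
  case (Suc a)
  define N' where "N' = N - 1"
  have N: "N = Suc N'" "a \<le> N'" using Suc.prems by (auto simp: N'_def)
  obtain u where u: "M = a * (N choose a) * u" using Suc.IH[of N] Suc.prems by auto
  obtain v where v: "M = a * (N' choose a) * v" using Suc.IH[of N'] Suc.prems N by auto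
  have pos: "0 < a" "0 < N' choose a" "0 < N choose a" using Suc.hyps N by auto
  have next_entry: "Suc a * (N choose Suc a) = N * (N' choose a)"
    using Suc_times_binomial_eq[of N' a] N by (simp add: mult.commute)
  have "(N - a) * (N choose a) = N * (N' choose a)"
    using binomial_absorb_comp[of N a] N by simp
  then have "int (N - a) * int (N choose a) = int N * int (N' choose a)"
    by (metis of_nat_mult)
  then have absorb: "(int N - int a) * int (N choose a) = int N * int (N' choose a)"
    using N by (simp add: of_nat_diff)
  have uv: "int (N choose a) * int u = int (N' choose a) * int v"
    using u v pos by (metis mult.assoc mult_cancel1 of_nat_mult neq0_conv)
  \<comment> \<open>In terms of quotients, the triangle rule says that \<open>M\<close> divided by
    \<open>N * (N' choose a)\<close> is \<open>v - u\<close>. It is verified over the integers and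
    multiplied by \<open>N choose a\<close>, so that \<open>uv\<close> and \<open>absorb\<close>
    apply.\<close>
  have "int (N choose a) * (int N * int (N' choose a) * (int v - int u)) =
     int N * int (N choose a) * (int (N' choose a) * int v) - int N * int (N' choose a) * (int (N choose a) * int u)"
    by (simp add: algebra_simps)
  also have "\<dots> = (int (N choose a) * int u) * (int N * int (N choose a) - int N * int (N' choose a))"
    unfolding uv[symmetric] by (simp add: algebra_simps)
  also have "\<dots> = (int (N choose a) * int u) * (int a * int (N choose a))"
    unfolding absorb[symmetric] by (simp add: algebra_simps)
  also have "\<dots> = int (N choose a) * int M"
    by (simp add: u algebra_simps)
  finally have "int N * int (N' choose a) * (int v - int u) = int M"
    using pos by simp
  then have "int (N * (N' choose a)) dvd int M"
    by (metis dvd_triv_left of_nat_mult)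
  then show ?case
    unfolding next_entry by (simp only: of_nat_dvd_iff)
qed

text \<open>The least common multiple of the positive numbers below \<open>p ^ k\<close> has
  valuation \<open>k - 1\<close>. The witness is a coarser multiple with the same valuation:
  \<open>p ^ (k - 1)\<close> times the product of all \<open>p\<close>-free parts.\<close>

lemma bounded_multiplicity_common_multiple:
  fixes p k :: nat
  assumes "prime p" "0 < k"
  obtains M where "0 < M" "multiplicity p M < k" "\<And>m. 1 \<le> m \<Longrightarrow> m < p ^ k \<Longrightarrow> m dvd M"
proof
  let ?M = "p ^ (k - 1) * (\<Prod>m\<in>{1..<p ^ k}. m div p ^ multiplicity p m)"
  have unit: "m div p ^ multiplicity p m \<noteq> 0 \<and> \<not> p dvd m div p ^ multiplicity p m" if "m \<in> {1..<p ^ k}" for m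
  proof -
    have "m \<noteq> 0" "\<not> is_unit p" using that assms(1) not_prime_unit by auto
    then show ?thesis
      using multiplicity_decompose[of m p] multiplicity_dvd[of p m] by (metis dvd_div_eq_0_iff)
  qed
  then show "0 < ?M" using assms(1) by (auto simp: prime_gt_0_nat prod_pos)
  have "\<not> p dvd (\<Prod>m\<in>{1..<p ^ k}. m div p ^ multiplicity p m)"
    using unit assms(1) by (auto simp: prime_dvd_prod_iff)
  then have "multiplicity p ?M = k - 1"
    using assms(1) by (intro multiplicity_eqI) (auto simp: prime_gt_0_nat)
  then show "multiplicity p ?M < k" using assms(2) by simp
  fix m assume m: "1 \<le> m" "m < p ^ k"
  have "p ^ multiplicity p m \<le> m"
    using m by (intro dvd_imp_le multiplicity_dvd) auto
  then have "p ^ multiplicity p m < p ^ k" using m by linarith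
  then have "multiplicity p m < k"
    using power_less_imp_less_exp[OF prime_gt_1_nat[OF assms(1)]] by blast
  then have "p ^ multiplicity p m dvd p ^ (k - 1)"
    by (intro le_imp_power_dvd) auto
  moreover have "m div p ^ multiplicity p m dvd (\<Prod>m\<in>{1..<p ^ k}. m div p ^ multiplicity p m)"
    using m by (intro dvd_prodI) auto
  moreover have "m = p ^ multiplicity p m * (m div p ^ multiplicity p m)"
    by (simp add: multiplicity_dvd)
  ultimately show "m dvd ?M" by (metis mult_dvd_mono)
qed

text \<open>\<open>fact (a + b - 1)\<close> is the product of \<open>fact (a - 1)\<close>,
  \<open>fact (b - 1)\<close> and \<open>a * ((a + b - 1) choose a)\<close>, and the last factor
  divides a number of valuation below \<open>k\<close>. Thus the extra \<open>p ^ k\<close> gained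
  by splitting a block in two outweighs the valuation lost in the factorials.\<close>

lemma multiplicity_fact_less:
  fixes p k a b :: nat
  assumes p: "prime p" and k: "0 < k" and ab: "1 \<le> a" "1 \<le> b" "a + b \<le> p ^ k"
  shows "multiplicity p (fact (a + b - 1) :: nat)
    < k + multiplicity p (fact (a - 1) :: nat) + multiplicity p (fact (b - 1) :: nat)"
proof -
  let ?v = "multiplicity p" and ?L = "a * ((a + b - 1) choose a)"
  obtain M where M: "0 < M" "?v M < k" "\<And>m. 1 \<le> m \<Longrightarrow> m < p ^ k \<Longrightarrow> m dvd M"
    using bounded_multiplicity_common_multiple[OF p k] by blast
  have "?L dvd M" by (rule mult_binomial_dvd[OF M(3)]) (use ab in auto)
  then have "?v ?L < k"
    using M dvd_imp_multiplicity_le[of ?L M p] by linarith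
  moreover have "(fact (a + b - 1) :: nat) = ?L * fact (a - 1) * fact (b - 1)"
  proof -
    have "(fact (a + b - 1) :: nat) = fact a * fact (b - 1) * (a + b - 1 choose a)"
      using binomial_fact_lemma[of a "a + b - 1"] ab by simp
    also have "(fact a :: nat) = a * fact (a - 1)"
      using ab by (simp add: fact_reduce)
    finally show ?thesis by simp
  qed
  moreover have "?v (?L * fact (a - 1) * fact (b - 1)) = ?v ?L + ?v (fact (a - 1)) + ?v (fact (b - 1))"
    using p ab by (subst prime_elem_multiplicity_mult_distrib | simp)+
  ultimately show ?thesis by simp
qed

section \<open>Valuation of the permanent\<close>

text \<open>In the expansion of \<open>inj_sum_newton\<close>, the term where the block of \<open>x\<close> is all of \<open>T\<close> has
  strictly smaller \<open>p\<close>-adic valuation than all the others.\<close>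
lemma inj_sum_padic:
  fixes K :: "'c \<Rightarrow> 'i \<Rightarrow> complex" and p k :: nat
  assumes p: "prime p" and k: "0 < k" and A: "finite A"
    and S: "\<And>B. B \<subseteq> I \<Longrightarrow> (\<Sum>c\<in>A. \<Prod>i\<in>B. K c i) = of_int (if Z B then int p ^ k else 0)"
  assumes T: "finite T" "T \<subseteq> I" "T \<noteq> {}" "card T \<le> p ^ k"
  shows "\<exists>z. inj_sum K A T = of_int z \<and>
    int p ^ (k + multiplicity p (fact (card T - 1) :: nat) + 1) dvd
      z - (if Z T then (-1) ^ (card T - 1) * int p ^ k * fact (card T - 1) else 0)"
  using T
proof (induction T rule: finite_psubset_induct)
  case (psubset T)
  define v where "v m = multiplicity p (fact (m - 1) :: nat)" for m
  have pv: "int p ^ v m dvd fact (m - 1)" for m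
  proof -
    have "p ^ v m dvd fact (m - 1)" unfolding v_def by (rule multiplicity_dvd)
    then have "int (p ^ v m) dvd int (fact (m - 1))" by (simp only: of_nat_dvd_iff)
    then show ?thesis by simp
  qed
  obtain x where x: "x \<in> T" using psubset.prems by blast
  define T' where "T' = T - {x}"
  have T': "finite T'" "x \<notin> T'" "insert x T' = T" "card T = Suc (card T')"
    using x psubset.hyps card.remove[of T x] by (auto simp: T'_def)
  \<comment> \<open>For a proper block, both the leading term and the error bound of the induction
    hypothesis contain \<open>p ^ (k + v (card (T' - C)))\<close>, whether or not \<open>Z\<close>
    holds for the remainder.\<close>
  have smaller: "\<exists>z. inj_sum K A (T' - C) = of_int z \<and> int p ^ (k + v (card (T' - C))) dvd z"
    if C: "C \<subset> T'" for C
  proof -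
    have "card (T' - C) \<le> p ^ k"
      using card_mono[OF T'(1), of "T' - C"] T'(4) psubset.prems(3) by auto
    moreover have "T' - C \<subset> T" "T' - C \<subseteq> I" "T' - C \<noteq> {}"
      using C psubset.prems x by (auto simp: T'_def)
    ultimately obtain z where z: "inj_sum K A (T' - C) = of_int z"
      "int p ^ (k + v (card (T' - C)) + 1) dvd
        z - (if Z (T' - C) then (-1) ^ (card (T' - C) - 1) * int p ^ k * fact (card (T' - C) - 1) else 0)"
      using psubset.IH[of "T' - C"] unfolding v_def by blast
    have "int p ^ (k + v (card (T' - C))) dvd
        z - (if Z (T' - C) then (-1) ^ (card (T' - C) - 1) * int p ^ k * fact (card (T' - C) - 1) else 0)"
      using z(2) by (rule dvd_trans[rotated]) (rule le_imp_power_dvd, simp)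
    moreover have "int p ^ (k + v (card (T' - C))) dvd
        (if Z (T' - C) then (-1) ^ (card (T' - C) - 1) * int p ^ k * fact (card (T' - C) - 1) else 0)"
      using pv[of "card (T' - C)"] by (simp add: power_add mult_dvd_mono)
    ultimately have "int p ^ (k + v (card (T' - C))) dvd z"
      using dvd_diffD1 by (metis dvd_add_right_iff diff_add_cancel add.commute)
    then show ?thesis using z by blast
  qed
  \<comment> \<open>The choice \<open>C = T'\<close> leaves an empty remainder, whose injection sum
    is 1; its term is the leading one.\<close>
  define main where "main = (if Z T then (-1) ^ card T' * int p ^ k * fact (card T') else 0)"
  have "\<exists>w. (-1) ^ card C * fact (card C) * (\<Sum>c\<in>A. \<Prod>i\<in>insert x C. K c i) * inj_sum K A (T' - C) = of_int w
      \<and> int p ^ (k + v (card T) + 1) dvd w - (if C = T' then main else 0)" if "C \<subseteq> T'" for C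
  proof (cases "C = T'")
    case True
    then show ?thesis
      using S[of T] psubset.prems T' by (intro exI[of _ main]) (auto simp: main_def)
  next
    case False
    then have C: "C \<subset> T'" using that by auto
    then obtain z where z: "inj_sum K A (T' - C) = of_int z" "int p ^ (k + v (card (T' - C))) dvd z"
      using smaller by blast
    define w where "w = (-1) ^ card C * fact (card C) * (if Z (insert x C) then int p ^ k else 0) * z"
    have "insert x C \<subseteq> I" using C psubset.prems x by (auto simp: T'_def)
    then have "(-1) ^ card C * fact (card C) * (\<Sum>c\<in>A. \<Prod>i\<in>insert x C. K c i) * inj_sum K A (T' - C) = of_int w"
      by (simp add: S z w_def)
    moreover have "int p ^ (k + v (card T) + 1) dvd w"
    proof -
      have "card (T' - C) = card T' - card C" "card C < card T'"
        using C T' by (auto simp: card_Diff_subset finite_subset psubset_card_mono)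
      \<comment> \<open>The two parts have sizes \<open>Suc (card C)\<close> and
        \<open>card (T' - C)\<close>, which add up to \<open>card T\<close>. One \<open>k\<close>
        comes from the block of \<open>x\<close> and one from the remainder; the strict inequality
        supplies the extra factor \<open>p\<close> of the modulus.\<close>
      then have "v (card T) < k + v (Suc (card C)) + v (card (T' - C))"
        using multiplicity_fact_less[OF p k, of "Suc (card C)" "card (T' - C)"] T' psubset.prems
        by (simp add: v_def)
      then have "int p ^ (k + v (card T) + 1) dvd int p ^ (v (Suc (card C)) + k + (k + v (card (T' - C))))"
        by (intro le_imp_power_dvd) simp
      also have "\<dots> = int p ^ v (Suc (card C)) * int p ^ k * int p ^ (k + v (card (T' - C)))"
        by (simp add: power_add)
      also have "\<dots> dvd fact (card C) * (if Z (insert x C) then int p ^ k else 0) * z"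
        using pv[of "Suc (card C)"] z by (intro mult_dvd_mono) auto
      also have "\<dots> dvd w" by (simp add: w_def mult.assoc)
      finally show ?thesis .
    qed
    ultimately show ?thesis using False by auto
  qed
  then obtain w where w: "\<And>C. C \<subseteq> T' \<Longrightarrow>
      (-1) ^ card C * fact (card C) * (\<Sum>c\<in>A. \<Prod>i\<in>insert x C. K c i) * inj_sum K A (T' - C) = of_int (w C)"
    "\<And>C. C \<subseteq> T' \<Longrightarrow> int p ^ (k + v (card T) + 1) dvd w C - (if C = T' then main else 0)"
    by metis
  have "inj_sum K A T = of_int (\<Sum>C\<in>Pow T'. w C)"
    using inj_sum_newton[OF T'(1) A T'(2), of K] T' w by simp
  moreover have "int p ^ (k + v (card T) + 1) dvd (\<Sum>C\<in>Pow T'. w C - (if C = T' then main else 0))"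
    using w by (intro dvd_sum) auto
  moreover have "(\<Sum>C\<in>Pow T'. w C - (if C = T' then main else 0)) = (\<Sum>C\<in>Pow T'. w C) - main"
    using T' by (simp add: sum_subtractf)
  ultimately show ?case
    using T' by (auto simp: main_def v_def intro!: exI[of _ "\<Sum>C\<in>Pow T'. w C"])
qed

text \<open>The leading term has valuation exactly \<open>k\<close> plus that of
  \<open>fact (card T - 1)\<close>, one less than the precision of \<open>inj_sum_padic\<close>, so
  it cannot cancel.\<close>

corollary inj_sum_nonzero:
  fixes K :: "'c \<Rightarrow> 'i \<Rightarrow> complex" and p k :: nat
  assumes p: "prime p" and k: "0 < k" and A: "finite A"
    and S: "\<And>B. B \<subseteq> T \<Longrightarrow> (\<Sum>c\<in>A. \<Prod>i\<in>B. K c i) \<in> {0, of_nat (p ^ k)}"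
    and full: "(\<Sum>c\<in>A. \<Prod>i\<in>T. K c i) \<noteq> 0"
    and T: "finite T" "T \<noteq> {}" "card T \<le> p ^ k"
  shows "inj_sum K A T \<noteq> 0"
proof
  assume zero: "inj_sum K A T = 0"
  define Z where "Z B \<longleftrightarrow> (\<Sum>c\<in>A. \<Prod>i\<in>B. K c i) \<noteq> 0" for B
  let ?e = "multiplicity p (fact (card T - 1) :: nat)"
  have "(\<Sum>c\<in>A. \<Prod>i\<in>B. K c i) = of_int (if Z B then int p ^ k else 0)" if "B \<subseteq> T" for B
    using S[OF that] by (auto simp: Z_def)
  from inj_sum_padic[OF p k A this T(1) _ T(2,3)] zero full
  have "int p ^ (k + ?e + 1) dvd (-1) ^ (card T - 1) * int p ^ k * fact (card T - 1)"
    by (auto simp: Z_def)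
  then have "int p ^ (k + ?e + 1) dvd int p ^ k * fact (card T - 1)"
    by (simp add: mult.assoc minus_one_power_iff split: if_splits)
  then have "int p ^ (?e + 1) dvd fact (card T - 1)"
    using p by (simp add: power_add mult.assoc prime_gt_0_nat)
  then have "int (p ^ (?e + 1)) dvd int (fact (card T - 1))" by simp
  then have "p ^ (?e + 1) dvd fact (card T - 1)" by (simp only: of_nat_dvd_iff)
  then show False
    using p by (subst (asm) power_dvd_iff_le_multiplicity) (auto simp: not_prime_unit)
qed

section \<open>Lifted matrices and invariant vectors\<close>

definition mode_lists :: "nat \<Rightarrow> nat list set" where
  "mode_lists n = {ms. set ms \<subseteq> {..<n} \<and> length ms = n}"

definition relabel :: "(nat \<Rightarrow> nat) \<Rightarrow> config \<Rightarrow> config" where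
  "relabel \<sigma> c = map (map_prod \<sigma> id) c"

lemma finite_mode_lists [simp]: "finite (mode_lists n)"
  unfolding mode_lists_def by (rule finite_lists_length_eq) simp

lemma mode_listsD: "ms \<in> mode_lists n \<Longrightarrow> length ms = n"
  "ms \<in> mode_lists n \<Longrightarrow> k < n \<Longrightarrow> ms ! k < n"
  by (auto simp: mode_lists_def subset_iff)

lemma valid_configD: "valid_config n c \<Longrightarrow> length c = n"
  "valid_config n c \<Longrightarrow> k < n \<Longrightarrow> fst (c ! k) < n"
  by (auto simp: valid_config_def)

lemma lift_eq:
  "valid_config n c \<Longrightarrow> lift n T \<psi> c =
    (\<Sum>ms\<in>mode_lists n. (\<Prod>k<n. T (fst (c ! k)) (ms ! k)) * \<psi> (zip ms (map snd c)))"
  "\<not> valid_config n c \<Longrightarrow> lift n T \<psi> c = 0"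
  by (simp_all add: lift_def mode_lists_def)

lemma lift_scale: "lift n T (\<lambda>c. a * \<psi> c) = (\<lambda>c. a * lift n T \<psi> c)"
  by (auto simp: fun_eq_iff lift_def sum_distrib_left mult.left_commute)

lemma lift_diff: "lift n T (\<lambda>c. \<psi> c - \<psi>' c) = (\<lambda>c. lift n T \<psi> c - lift n T \<psi>' c)"
  by (auto simp: fun_eq_iff lift_def sum_subtractf right_diff_distrib)

lemma valid_config_zip:
  "ms \<in> mode_lists n \<Longrightarrow> length is = n \<Longrightarrow> valid_config n (zip ms is)"
  by (auto simp: valid_config_def mode_lists_def subset_iff dest: set_zip_leftD)

lemma modes_in_mode_lists: "valid_config n c \<Longrightarrow> map fst c \<in> mode_lists n"
  by (auto simp: valid_config_def mode_lists_def)

lemma relabel_zip: "length ms = length is \<Longrightarrow> relabel \<sigma> (zip ms is) = zip (map \<sigma> ms) is"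
  by (auto simp: relabel_def intro!: nth_equalityI)

lemma relabel_simps [simp]:
  "length (relabel \<sigma> c) = length c" "map snd (relabel \<sigma> c) = map snd c"
  "k < length c \<Longrightarrow> fst (relabel \<sigma> c ! k) = \<sigma> (fst (c ! k))"
  by (auto simp: relabel_def)

lemma valid_config_relabel:
  assumes "\<sigma> permutes {..<n}"
  shows "valid_config n (relabel \<sigma> c) \<longleftrightarrow> valid_config n c"
  using permutes_in_image[OF assms] by (auto simp: valid_config_def relabel_def)

lemma map_permutes_mode_lists:
  assumes "\<sigma> permutes {..<n}" "ms \<in> mode_lists n"
  shows "map \<sigma> ms \<in> mode_lists n"
  using assms permutes_in_image[OF assms(1)] by (auto simp: mode_lists_def subset_iff)

text \<open>Only one mode list contributes: the preimage under \<sigma> of the modes of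
  \<open>c\<close>. Hence coordinates are pulled back along \<open>inv \<sigma>\<close>.\<close>

lemma lift_perm_mat:
  assumes \<sigma>: "\<sigma> permutes {..<n}" and c: "valid_config n c"
  shows "lift n (perm_mat \<sigma>) \<psi> c = \<psi> (relabel (inv \<sigma>) c)"
proof -
  let ?m = "map (inv \<sigma>) (map fst c)"
  have m: "?m \<in> mode_lists n"
    using map_permutes_mode_lists[OF permutes_inv[OF \<sigma>] modes_in_mode_lists[OF c]] .
  have "(\<Prod>k<n. perm_mat \<sigma> (fst (c ! k)) (ms ! k)) = (if ms = ?m then 1 else 0)"
    if "ms \<in> mode_lists n" for ms
  proof (cases "ms = ?m")
    case True
    then show ?thesis using c permutes_inverses(1)[OF \<sigma>] by (auto simp: perm_mat_def valid_config_def)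
  next
    case False
    have "\<exists>k<n. fst (c ! k) \<noteq> \<sigma> (ms ! k)"
    proof (rule ccontr)
      assume "\<not> ?thesis"
      then have "ms = ?m"
        using c that by (intro nth_equalityI) (auto simp: valid_configD mode_listsD permutes_inverses[OF \<sigma>])
      with False show False by simp
    qed
    then show ?thesis using False by (auto simp: perm_mat_def prod_zero_iff)
  qed
  then have "lift n (perm_mat \<sigma>) \<psi> c = (\<Sum>ms\<in>mode_lists n. if ms = ?m then \<psi> (zip ms (map snd c)) else 0)"
    unfolding lift_eq(1)[OF c] by (intro sum.cong) auto
  also have "\<dots> = \<psi> (zip ?m (map snd c))"
    using m by simp
  also have "zip ?m (map snd c) = relabel (inv \<sigma>) c"
    by (simp add: relabel_def zip_map_map zip_same_conv_map) (auto simp: case_prod_unfold map_prod_def)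
  finally show ?thesis .
qed

lemma in_eig_relabel:
  assumes "in_eig n G \<psi>" "\<sigma> \<in> G" "\<sigma> permutes {..<n}" "valid_config n c"
  shows "\<psi> (relabel \<sigma> c) = \<psi> c"
proof -
  have "relabel (inv \<sigma>) (relabel \<sigma> c) = c"
    using permutes_inverses(2)[OF assms(3)] by (simp add: relabel_def o_def map_prod_def case_prod_unfold)
  moreover have "lift n (perm_mat \<sigma>) \<psi> = \<psi>" using assms by (simp add: in_eig_def)
  ultimately show ?thesis
    using lift_perm_mat[OF assms(3), of "relabel \<sigma> c" \<psi>] assms(3,4)
    by (simp add: valid_config_relabel)
qed

text \<open>Grouping the photons by mode turns a product of eigenvalues over photons into the
  product over modes that defines the admissible patterns.\<close>

lemma prod_modes_occ:
  fixes f :: "nat \<Rightarrow> 'a::comm_monoid_mult"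
  assumes "valid_config n c"
  shows "(\<Prod>k<n. f (fst (c ! k))) = (\<Prod>j<n. f j ^ occ c j)"
proof -
  have "(\<Prod>k<n. f (fst (c ! k))) = (\<Prod>j<n. \<Prod>k\<in>{k\<in>{..<n}. fst (c ! k) = j}. f (fst (c ! k)))"
    by (rule prod.group[symmetric]) (use assms in \<open>auto simp: valid_configD\<close>)
  also have "\<dots> = (\<Prod>j<n. f j ^ occ c j)"
    using assms by (intro prod.cong) (auto simp: occ_def length_filter_conv_card valid_configD)
  finally show ?thesis .
qed

lemma sum_occ:
  assumes "valid_config n c"
  shows "(\<Sum>j<n. occ c j) = n"
proof -
  have "(\<Sum>k<n. Suc 0) = (\<Sum>j<n. \<Sum>k\<in>{k\<in>{..<n}. fst (c ! k) = j}. Suc 0)"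
    by (rule sum.group[symmetric]) (use assms in \<open>auto simp: valid_configD\<close>)
  also have "\<dots> = (\<Sum>j<n. occ c j)"
    using assms by (intro sum.cong) (auto simp: occ_def length_filter_conv_card valid_configD)
  finally show ?thesis by simp
qed

text \<open>\<open>U P = D U\<close>, entrywise.\<close>
definition intertwines :: "nat \<Rightarrow> mat \<Rightarrow> (nat \<Rightarrow> nat) \<Rightarrow> (nat \<Rightarrow> complex) \<Rightarrow> bool" where
  "intertwines n U \<sigma> e \<longleftrightarrow> (\<forall>i<n. \<forall>j<n. U i (\<sigma> j) = e i * U i j)"

text \<open>Replacing \<open>ms\<close> by \<open>map \<sigma> ms\<close> leaves \<psi> unchanged
  and draws one factor of \<open>e\<close> from each entry of \<open>U\<close>. A coordinate whose
  total factor differs from 1 must therefore vanish.\<close>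

lemma lift_intertwines:
  assumes \<sigma>: "\<sigma> permutes {..<n}" and U: "intertwines n U \<sigma> e"
    and inv: "\<And>b. valid_config n b \<Longrightarrow> \<psi> (relabel \<sigma> b) = \<psi> b"
    and c: "valid_config n c"
  shows "lift n U \<psi> c = (\<Prod>j<n. e j ^ occ c j) * lift n U \<psi> c"
proof -
  have "lift n U \<psi> c = (\<Sum>ms\<in>mode_lists n. (\<Prod>k<n. U (fst (c ! k)) (map \<sigma> ms ! k)) * \<psi> (zip (map \<sigma> ms) (map snd c)))"
    unfolding lift_eq(1)[OF c]
    by (rule sum.reindex_bij_witness[where i="map \<sigma>" and j="map (inv \<sigma>)"])
      (auto simp: permutes_inverses[OF \<sigma>] o_def map_permutes_mode_lists \<sigma> permutes_inv)
  also have "\<dots> = (\<Sum>ms\<in>mode_lists n. (\<Prod>j<n. e j ^ occ c j) * ((\<Prod>k<n. U (fst (c ! k)) (ms ! k)) * \<psi> (zip ms (map snd c))))"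
  proof (rule sum.cong[OF refl])
    fix ms assume ms: "ms \<in> mode_lists n"
    have "(\<Prod>k<n. U (fst (c ! k)) (map \<sigma> ms ! k)) = (\<Prod>k<n. e (fst (c ! k)) * U (fst (c ! k)) (ms ! k))"
      using U c ms by (intro prod.cong) (auto simp: intertwines_def mode_listsD valid_configD)
    moreover have "\<psi> (zip (map \<sigma> ms) (map snd c)) = \<psi> (zip ms (map snd c))"
      using inv[OF valid_config_zip[OF ms, of "map snd c"]] c ms
      by (simp add: relabel_zip mode_listsD valid_configD)
    ultimately show "(\<Prod>k<n. U (fst (c ! k)) (map \<sigma> ms ! k)) * \<psi> (zip (map \<sigma> ms) (map snd c)) =
        (\<Prod>j<n. e j ^ occ c j) * ((\<Prod>k<n. U (fst (c ! k)) (ms ! k)) * \<psi> (zip ms (map snd c)))"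
      by (simp add: prod.distrib prod_modes_occ[OF c] mult.assoc)
  qed
  finally show ?thesis
    unfolding sum_distrib_left[symmetric] lift_eq(1)[OF c] .
qed

section \<open>Adjoint basis vectors and the projection onto the eigenspace\<close>

text \<open>Coordinate \<open>c\<close> of \<open>lift n U \<psi>\<close> is the inner product of \<open>\<psi>\<close> with the adjoint of \<open>lift n U\<close>
  applied to the basis vector of \<open>c\<close>.\<close>
definition adjoint_basis :: "nat \<Rightarrow> mat \<Rightarrow> config \<Rightarrow> vec" where
  "adjoint_basis n U c b = (if valid_config n b \<and> map snd b = map snd c
     then cnj (\<Prod>k<n. U (fst (c ! k)) (fst (b ! k))) else 0)"

text \<open>The internal indices are those of \<open>c\<close> and only the modes vary, so
  \<open>adjoint_basis n U c\<close> has finite support although there are infinitely many internal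
  states.\<close>

lemma adjoint_basis_support:
  assumes "valid_config n c"
  shows "{b. valid_config n b \<and> map snd b = map snd c} = (\<lambda>ms. zip ms (map snd c)) ` mode_lists n"
proof (intro subset_antisym subsetI)
  fix b assume b: "b \<in> {b. valid_config n b \<and> map snd b = map snd c}"
  then have "b = zip (map fst b) (map snd c)"
    using zip_map_fst_snd[of b] by simp
  then show "b \<in> (\<lambda>ms. zip ms (map snd c)) ` mode_lists n"
    using b modes_in_mode_lists by blast
next
  fix b assume "b \<in> (\<lambda>ms. zip ms (map snd c)) ` mode_lists n"
  then show "b \<in> {b. valid_config n b \<and> map snd b = map snd c}"
    using assms by (auto simp: valid_config_zip mode_listsD valid_configD)
qed

lemma inner_adjoint_basis:
  assumes c: "valid_config n c"
  shows "inner_v (adjoint_basis n U c) \<psi> = lift n U \<psi> c"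
proof -
  let ?z = "\<lambda>ms. zip ms (map snd c)"
  have "inner_v (adjoint_basis n U c) \<psi> = (\<Sum>\<^sub>\<infinity>b\<in>?z ` mode_lists n. cnj (adjoint_basis n U c b) * \<psi> b)"
    unfolding inner_v_def adjoint_basis_support[OF c, symmetric]
    by (rule infsum_cong_neutral) (auto simp: adjoint_basis_def)
  also have "\<dots> = (\<Sum>b\<in>?z ` mode_lists n. cnj (adjoint_basis n U c b) * \<psi> b)"
    by simp
  also have "\<dots> = (\<Sum>ms\<in>mode_lists n. cnj (adjoint_basis n U c (?z ms)) * \<psi> (?z ms))"
  proof (rule sum.reindex[unfolded o_def])
    show "inj_on ?z (mode_lists n)"
      using c by (intro inj_onI) (metis length_map map_fst_zip mode_listsD(1) valid_configD(1))
  qed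
  also have "\<dots> = lift n U \<psi> c"
    unfolding lift_eq(1)[OF c]
  proof (rule sum.cong[OF refl])
    fix ms assume ms: "ms \<in> mode_lists n"
    have "(\<Prod>k<n. U (fst (c ! k)) (fst (?z ms ! k))) = (\<Prod>k<n. U (fst (c ! k)) (ms ! k))"
      using c ms by (intro prod.cong) (auto simp: mode_listsD valid_configD)
    then show "cnj (adjoint_basis n U c (?z ms)) * \<psi> (?z ms) = (\<Prod>k<n. U (fst (c ! k)) (ms ! k)) * \<psi> (?z ms)"
      using c ms by (simp add: adjoint_basis_def valid_config_zip mode_listsD valid_configD)
  qed
  finally show ?thesis .
qed

lemma in_space_finite_support:
  assumes "finite {b. \<psi> b \<noteq> 0}" "\<And>b. \<psi> b \<noteq> 0 \<Longrightarrow> valid_config n b"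
  shows "in_space n \<psi>"
proof -
  have "(\<lambda>c. (cmod (\<psi> c))\<^sup>2) summable_on UNIV \<longleftrightarrow> (\<lambda>c. (cmod (\<psi> c))\<^sup>2) summable_on {b. \<psi> b \<noteq> 0}"
    by (rule summable_on_cong_neutral) auto
  then show ?thesis using assms by (auto simp: in_space_def)
qed

text \<open>Shifting the column indices of \<open>U\<close> by \<sigma> brings out one eigenvalue
  per photon, and \<open>fix1\<close> says that their product is 1.\<close>

lemma adjoint_basis_in_eig:
  assumes perm: "\<And>\<sigma>. \<sigma> \<in> G \<Longrightarrow> \<sigma> permutes {..<n}"
    and U: "\<And>\<sigma>. \<sigma> \<in> G \<Longrightarrow> intertwines n U \<sigma> (d \<sigma>)"
    and c: "valid_config n c" and fix1: "\<And>\<sigma>. \<sigma> \<in> G \<Longrightarrow> (\<Prod>j<n. d \<sigma> j ^ occ c j) = 1"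
  shows "in_eig n G (adjoint_basis n U c)"
  unfolding in_eig_def
proof (intro conjI ballI ext)
  have "finite {b. valid_config n b \<and> map snd b = map snd c}"
    unfolding adjoint_basis_support[OF c] by simp
  then show "in_space n (adjoint_basis n U c)"
    by (intro in_space_finite_support) (auto simp: adjoint_basis_def elim: rev_finite_subset split: if_splits)
next
  fix \<sigma> b assume \<sigma>: "\<sigma> \<in> G"
  note p = perm[OF \<sigma>]
  show "lift n (perm_mat \<sigma>) (adjoint_basis n U c) b = adjoint_basis n U c b"
  proof (cases "valid_config n b")
    case False
    then show ?thesis by (simp add: lift_eq adjoint_basis_def)
  next
    case b: True
    have "U (fst (c ! k)) (fst (b ! k)) = d \<sigma> (fst (c ! k)) * U (fst (c ! k)) (inv \<sigma> (fst (b ! k)))" if "k < n" for k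
    proof -
      have "inv \<sigma> (fst (b ! k)) < n"
        using permutes_in_image[OF permutes_inv[OF p]] valid_configD(2)[OF b that] by auto
      then have "U (fst (c ! k)) (\<sigma> (inv \<sigma> (fst (b ! k)))) = d \<sigma> (fst (c ! k)) * U (fst (c ! k)) (inv \<sigma> (fst (b ! k)))"
        using U[OF \<sigma>] valid_configD(2)[OF c that] by (auto simp: intertwines_def)
      then show ?thesis by (simp add: permutes_inverses[OF p])
    qed
    then have "(\<Prod>k<n. U (fst (c ! k)) (fst (b ! k))) =
        (\<Prod>k<n. d \<sigma> (fst (c ! k))) * (\<Prod>k<n. U (fst (c ! k)) (inv \<sigma> (fst (b ! k))))"
      by (simp add: prod.distrib)
    also have "\<dots> = (\<Prod>k<n. U (fst (c ! k)) (fst (relabel (inv \<sigma>) b ! k)))"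
      using b by (simp add: prod_modes_occ[OF c] fix1[OF \<sigma>] valid_configD)
    finally show ?thesis
      using b p by (simp add: lift_perm_mat adjoint_basis_def valid_config_relabel permutes_inv)
  qed
qed

text \<open>The difference of \<eta> and \<phi> is orthogonal to every invariant vector, in
  particular to the adjoint basis vector of \<open>c\<close>; that inner product is the difference
  of the two coordinates.\<close>

lemma lift_eig_projection:
  assumes perm: "\<And>\<sigma>. \<sigma> \<in> G \<Longrightarrow> \<sigma> permutes {..<n}"
    and U: "\<And>\<sigma>. \<sigma> \<in> G \<Longrightarrow> intertwines n U \<sigma> (d \<sigma>)"
    and proj: "is_eig_projection n G \<eta> \<phi>"
    and fix1: "\<And>\<sigma>. \<sigma> \<in> G \<Longrightarrow> (\<Prod>j<n. d \<sigma> j ^ occ c j) = 1"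
  shows "lift n U \<eta> c = lift n U \<phi> c"
proof (cases "valid_config n c")
  case c: True
  have "inner_v (adjoint_basis n U c) (\<lambda>c. \<eta> c - \<phi> c) = 0"
    using adjoint_basis_in_eig[OF perm U c fix1] proj by (auto simp: is_eig_projection_def)
  then show ?thesis by (simp add: inner_adjoint_basis[OF c] lift_diff)
qed (simp add: lift_eq)

section \<open>Inner products, norms and square-summability\<close>

lemma inner_summable:
  assumes "in_space n \<phi>" "in_space n \<psi>"
  shows "(\<lambda>c. cnj (\<phi> c) * \<psi> c) summable_on UNIV"
proof (rule abs_summable_summable)
  have "(\<lambda>c. (cmod (\<phi> c))\<^sup>2 + (cmod (\<psi> c))\<^sup>2) summable_on UNIV"
    using assms by (intro summable_on_add) (auto simp: in_space_def)
  moreover have "norm (cnj (\<phi> c) * \<psi> c) \<le> (cmod (\<phi> c))\<^sup>2 + (cmod (\<psi> c))\<^sup>2" for c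
    using sum_squares_bound[of "cmod (\<phi> c)" "cmod (\<psi> c)"]
      mult_nonneg_nonneg[OF norm_ge_zero[of "\<phi> c"] norm_ge_zero[of "\<psi> c"]]
    unfolding norm_mult complex_mod_cnj by linarith
  ultimately show "(\<lambda>c. norm (cnj (\<phi> c) * \<psi> c)) summable_on UNIV"
    by (rule Infinite_Sum.abs_summable_on_comparison_test')
qed

lemma normsq_pos:
  assumes "in_space n \<phi>" "\<phi> \<noteq> (\<lambda>_. 0)"
  shows "0 < normsq_v \<phi>"
proof -
  obtain c where "\<phi> c \<noteq> 0" using assms by (auto simp: fun_eq_iff)
  then have "0 < (cmod (\<phi> c))\<^sup>2" by simp
  also have "\<dots> = (\<Sum>\<^sub>\<infinity>c\<in>{c}. (cmod (\<phi> c))\<^sup>2)" by simp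
  also have "\<dots> \<le> normsq_v \<phi>"
    unfolding normsq_v_def using assms
    by (intro infsum_mono_neutral) (auto simp: in_space_def)
  finally show ?thesis .
qed

lemma inner_self:
  assumes "in_space n \<phi>"
  shows "inner_v \<phi> \<phi> = complex_of_real (normsq_v \<phi>)"
proof -
  have "((\<lambda>c. complex_of_real ((cmod (\<phi> c))\<^sup>2)) has_sum complex_of_real (normsq_v \<phi>)) UNIV"
    using assms unfolding has_sum_of_real_iff normsq_v_def in_space_def by (blast intro: has_sum_infsum)
  moreover have "complex_of_real ((cmod (\<phi> c))\<^sup>2) = cnj (\<phi> c) * \<phi> c" for c
    by (metis complex_norm_square mult.commute)
  ultimately show ?thesis by (simp add: inner_v_def infsumI)
qed

text \<open>As \<phi> is orthogonal to the difference of \<eta> and \<phi>, its inner product with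
  \<eta> is its own squared norm; normalising leaves the norm, a positive real number.\<close>

lemma inner_normalized_eig_projection:
  assumes proj: "is_eig_projection n G \<eta> \<phi>" and "in_space n \<eta>" "\<phi> \<noteq> (\<lambda>_. 0)"
  shows "inner_v (normalize_v \<phi>) \<eta> = complex_of_real (sqrt (normsq_v \<phi>))"
proof -
  have \<phi>: "in_eig n G \<phi>" "in_space n \<phi>" using proj by (auto simp: is_eig_projection_def in_eig_def)
  have "0 = inner_v \<phi> (\<lambda>c. \<eta> c - \<phi> c)" using proj \<phi> by (auto simp: is_eig_projection_def)
  \<comment> \<open>The infinite sum splits because both families are summable, by
    \<open>inner_summable\<close>.\<close>
  also have "\<dots> = inner_v \<phi> \<eta> - inner_v \<phi> \<phi>"
    using infsum_add[OF inner_summable[OF \<phi>(2) assms(2)] summable_on_uminus[THEN iffD2, OF inner_summable[OF \<phi>(2) \<phi>(2)]]]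
    by (simp add: inner_v_def right_diff_distrib infsum_uminus)
  finally have eq: "inner_v \<phi> \<eta> = complex_of_real (normsq_v \<phi>)" by (simp add: inner_self[OF \<phi>(2)])
  let ?N = "complex_of_real (sqrt (normsq_v \<phi>))"
  have "inner_v (normalize_v \<phi>) \<eta> = inverse ?N * inner_v \<phi> \<eta>"
    unfolding inner_v_def normalize_v_def infsum_cmult_right'[symmetric]
    by (intro infsum_cong) (simp add: field_simps)
  also have "\<dots> = ?N"
    using normsq_pos[OF \<phi>(2) assms(3)]
    by (simp add: eq field_simps flip: of_real_mult)
  finally show ?thesis .
qed

text \<open>Each coordinate combines finitely many coordinates of \<psi> with uniformly bounded
  coefficients, so Cauchy-Schwarz dominates its square by a finite sum of squares.\<close>

lemma lift_square_summable:
  assumes "in_space n \<psi>"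
  shows "(\<lambda>c. (cmod (lift n U \<psi> c))\<^sup>2) summable_on UNIV"
proof -
  let ?V = "{c. valid_config n c}"
  \<comment> \<open>On \<open>W m\<close> the modes of \<open>c\<close> are fixed, so
    \<open>zip ms (map snd c)\<close> is an injective function of \<open>c\<close> there; finitely
    many such sets cover all valid configurations.\<close>
  define W where "W m = {c. valid_config n c \<and> map fst c = m}" for m
  have term_summable: "(\<lambda>c. (cmod (\<psi> (zip ms (map snd c))))\<^sup>2) summable_on ?V" if ms: "ms \<in> mode_lists n" for ms
  proof -
    have V: "?V = (\<Union>m\<in>mode_lists n. W m)"
      using modes_in_mode_lists by (auto simp: W_def)
    have "(\<lambda>c. (cmod (\<psi> (zip ms (map snd c))))\<^sup>2) summable_on W m" for m
    proof -
      have "inj_on (\<lambda>c. zip ms (map snd c)) (W m)"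
      proof (rule inj_onI)
        fix b c assume bc: "b \<in> W m" "c \<in> W m" "zip ms (map snd b) = zip ms (map snd c)"
        then have "length ms = length b" "length ms = length c"
          using ms by (auto simp: W_def mode_listsD valid_configD)
        then have "map snd b = map snd c" using bc(3) by (metis length_map map_snd_zip)
        then show "b = c" using bc by (metis (mono_tags, lifting) W_def mem_Collect_eq zip_map_fst_snd)
      qed
      then show ?thesis
        using summable_on_reindex[of "\<lambda>c. zip ms (map snd c)" "W m" "\<lambda>c. (cmod (\<psi> c))\<^sup>2"]
          summable_on_subset_banach[of "\<lambda>c. (cmod (\<psi> c))\<^sup>2" UNIV] assms
        by (simp add: in_space_def o_def)
    qed
    then show ?thesis
      unfolding V by (intro summable_on_finite_union_disjoint) (auto simp: W_def)
  qed
  define T where "T m m' = cmod (\<Prod>k<n. U (m ! k) (m' ! k))" for m m'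
  \<comment> \<open>A crude bound for all coefficients at once: the sum of all their moduli.\<close>
  define R where "R = (\<Sum>m\<in>mode_lists n. \<Sum>m'\<in>mode_lists n. T m m')"
  have T_le: "T m m' \<le> R" if "m \<in> mode_lists n" "m' \<in> mode_lists n" for m m'
  proof -
    have "T m m' \<le> (\<Sum>m'\<in>mode_lists n. T m m')"
      using that by (intro member_le_sum) (auto simp: T_def)
    also have "\<dots> \<le> R" unfolding R_def
      using that by (intro member_le_sum[of m _ "\<lambda>m. \<Sum>m'\<in>mode_lists n. T m m'"]) (auto simp: T_def intro!: sum_nonneg)
    finally show ?thesis .
  qed
  have "(\<lambda>c. (cmod (lift n U \<psi> c))\<^sup>2) summable_on ?V"
  proof (rule summable_on_comparison_test)
    let ?g = "\<lambda>c. (\<Sum>ms\<in>mode_lists n. (cmod (\<psi> (zip ms (map snd c))))\<^sup>2)"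
    have "(\<lambda>c. \<Sum>ms\<in>F. (cmod (\<psi> (zip ms (map snd c))))\<^sup>2) summable_on ?V"
      if "finite F" "F \<subseteq> mode_lists n" for F
      using that term_summable by (induction F rule: finite_induct) (auto intro!: summable_on_add)
    from this[of "mode_lists n"] have "?g summable_on ?V" by simp
    then show "(\<lambda>c. R\<^sup>2 * real (card (mode_lists n)) * ?g c) summable_on ?V"
      by (rule summable_on_cmult_right)
    fix c assume "c \<in> ?V"
    then have c: "valid_config n c" by simp
    have "cmod (lift n U \<psi> c) \<le> (\<Sum>ms\<in>mode_lists n. R * cmod (\<psi> (zip ms (map snd c))))"
      unfolding lift_eq(1)[OF c]
    proof (rule sum_norm_le)
      fix ms assume ms: "ms \<in> mode_lists n"
      have "(\<Prod>k<n. U (fst (c ! k)) (ms ! k)) = (\<Prod>k<n. U (map fst c ! k) (ms ! k))"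
        using c by (intro prod.cong) (auto simp: valid_configD)
      then show "cmod ((\<Prod>k<n. U (fst (c ! k)) (ms ! k)) * \<psi> (zip ms (map snd c))) \<le> R * cmod (\<psi> (zip ms (map snd c)))"
        using T_le[OF modes_in_mode_lists[OF c] ms] by (simp add: norm_mult T_def mult_right_mono)
    qed
    then have "(cmod (lift n U \<psi> c))\<^sup>2 \<le> (R * (\<Sum>ms\<in>mode_lists n. cmod (\<psi> (zip ms (map snd c)))))\<^sup>2"
      by (simp add: power_mono sum_distrib_left)
    also have "\<dots> \<le> R\<^sup>2 * (?g c * real (card (mode_lists n)))"
      unfolding power_mult_distrib by (intro mult_left_mono sum_squared_le_sum_of_squares) auto
    finally show "(cmod (lift n U \<psi> c))\<^sup>2 \<le> R\<^sup>2 * real (card (mode_lists n)) * ?g c"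
      by (simp add: mult_ac)
  qed auto
  moreover have "(\<lambda>c. (cmod (lift n U \<psi> c))\<^sup>2) summable_on ?V \<longleftrightarrow> (\<lambda>c. (cmod (lift n U \<psi> c))\<^sup>2) summable_on UNIV"
    by (rule summable_on_cong_neutral) (auto simp: lift_eq)
  ultimately show ?thesis by simp
qed

section \<open>Amplitudes of the all-ones input\<close>

lemma occ_mset:
  assumes "mset c = mset c'"
  shows "occ c = occ c'"
proof
  have "occ b j = size (filter_mset (\<lambda>p. fst p = j) (mset b))" for b j
    by (simp add: occ_def flip: mset_filter)
  then show "occ c j = occ c' j" for j using assms by simp
qed

lemma valid_config_mset:
  assumes "mset c = mset c'"
  shows "valid_config n c = valid_config n c'"
  unfolding valid_config_def using mset_eq_setD[OF assms] mset_eq_length[OF assms] by simp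

lemma fock_state_symmetric: "symmetric_v (fock_state n s)"
proof -
  have "fock_state n s c = fock_state n s c'" if "mset c = mset c'" for c c'
    unfolding fock_state_def occ_mset[OF that] valid_config_mset[OF that] mset_eq_setD[OF that] ..
  then show ?thesis unfolding symmetric_v_def by blast
qed

lemma permute_list_mode_lists:
  "\<pi> permutes {..<n} \<Longrightarrow> ms \<in> mode_lists n \<Longrightarrow> permute_list \<pi> ms \<in> mode_lists n"
  by (auto simp: mode_lists_def)

lemma permute_list_inverse:
  assumes "\<pi> permutes {..<length xs}"
  shows "permute_list \<pi> (permute_list (inv \<pi>) xs) = xs"
  using permute_list_compose[OF assms, of "inv \<pi>"] permutes_inv_o[OF assms] by simp

lemma permute_list_inverse':
  assumes "\<pi> permutes {..<length xs}"
  shows "permute_list (inv \<pi>) (permute_list \<pi> xs) = xs"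
  using permute_list_compose[OF permutes_inv[OF assms], of \<pi>] permutes_inv_o[OF assms] by simp

text \<open>The same matrix acts on every photon, so a reordering of the output photons is undone by
  reordering the mode lists in the sum.\<close>

lemma lift_symmetric:
  assumes sym: "symmetric_v \<psi>"
  shows "symmetric_v (lift n T \<psi>)"
  unfolding symmetric_v_def
proof (intro allI impI)
  fix b c :: config assume bc: "mset b = mset c"
  show "lift n T \<psi> b = lift n T \<psi> c"
  proof (cases "valid_config n c")
    case False
    then show ?thesis using valid_config_mset[OF bc] by (simp add: lift_eq)
  next
    case c: True
    then have b: "valid_config n b" using valid_config_mset[OF bc] by simp
    obtain \<pi> where \<pi>: "\<pi> permutes {..<length c}" "permute_list \<pi> c = b"
      using mset_eq_permutation[OF bc] by metis
    then have \<pi>n: "\<pi> permutes {..<n}" using c by (simp add: valid_configD)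
    have "lift n T \<psi> b = (\<Sum>ms\<in>mode_lists n.
        (\<Prod>k<n. T (fst (b ! k)) (permute_list \<pi> ms ! k)) * \<psi> (zip (permute_list \<pi> ms) (map snd b)))"
      unfolding lift_eq(1)[OF b]
      by (rule sum.reindex_bij_witness[where i="permute_list \<pi>" and j="permute_list (inv \<pi>)"])
        (use \<pi>n in \<open>auto simp: permute_list_inverse permute_list_inverse' mode_listsD permute_list_mode_lists permutes_inv\<close>)
    also have "\<dots> = lift n T \<psi> c"
      unfolding lift_eq(1)[OF c]
    proof (rule sum.cong[OF refl])
      fix ms assume ms: "ms \<in> mode_lists n"
      have "(\<Prod>k<n. T (fst (b ! k)) (permute_list \<pi> ms ! k)) = (\<Prod>k<n. T (fst (c ! \<pi> k)) (ms ! \<pi> k))"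
        using \<pi> \<pi>n ms c by (intro prod.cong) (auto simp: permute_list_nth mode_listsD valid_configD)
      also have "\<dots> = (\<Prod>k<n. T (fst (c ! k)) (ms ! k))"
        using prod.permute[OF \<pi>n, of "\<lambda>k. T (fst (c ! k)) (ms ! k)"] by (simp add: o_def)
      finally have T: "(\<Prod>k<n. T (fst (b ! k)) (permute_list \<pi> ms ! k)) = (\<Prod>k<n. T (fst (c ! k)) (ms ! k))" .
      have "zip (permute_list \<pi> ms) (map snd b) = permute_list \<pi> (zip ms (map snd c))"
        using \<pi> \<pi>n ms c by (auto simp: permute_list_zip permute_list_map mode_listsD valid_configD simp flip: \<pi>(2))
      moreover have "mset (permute_list \<pi> (zip ms (map snd c))) = mset (zip ms (map snd c))"
        using \<pi>n ms c by (intro mset_permute_list) (simp add: mode_listsD valid_configD)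
      ultimately have "\<psi> (zip (permute_list \<pi> ms) (map snd b)) = \<psi> (zip ms (map snd c))"
        using sym unfolding symmetric_v_def by metis
      with T show "(\<Prod>k<n. T (fst (b ! k)) (permute_list \<pi> ms ! k)) * \<psi> (zip (permute_list \<pi> ms) (map snd b)) =
          (\<Prod>k<n. T (fst (c ! k)) (ms ! k)) * \<psi> (zip ms (map snd c))"
        by (simp only:)
    qed
    finally show ?thesis .
  qed
qed

lemma count_indistinguishable:
  assumes "\<forall>p\<in>set c. snd p = 0"
  shows "count (mset c) (j, i) = (if i = 0 then occ c j else 0)"
  using assms by (induction c) (auto simp: occ_def)

lemma mset_indistinguishable:
  assumes "valid_config n b" "valid_config n c" "\<forall>p\<in>set b. snd p = 0" "\<forall>p\<in>set c. snd p = 0"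
    "\<forall>j<n. occ b j = occ c j"
  shows "mset b = mset c"
proof (rule multiset_eqI)
  fix x :: "nat \<times> nat"
  have "occ b j = occ c j" for j
  proof (cases "j < n")
    case False
    then have "occ b j = 0" "occ c j = 0"
      using assms(1,2) by (auto simp: occ_def valid_config_def filter_empty_conv)
    then show ?thesis by simp
  qed (use assms in auto)
  then show "count (mset b) x = count (mset c) x"
    using assms by (cases x) (simp add: count_indistinguishable)
qed

text \<open>The Fock state is constant on the photon orderings of \<open>c\<close> and zero
  elsewhere, and \<psi> takes one value on them. Whether an amplitude vanishes is thus decided by a
  single coordinate.\<close>

lemma inner_fock_state:
  assumes sym: "symmetric_v \<psi>" and c: "valid_config n c" "\<forall>p\<in>set c. snd p = 0" "\<forall>j<n. occ c j = s j"
  shows "\<exists>a. a \<noteq> 0 \<and> inner_v (fock_state n s) \<psi> = a * \<psi> c"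
proof -
  define S where "S = {b. mset b = mset c}"
  define a where "a = complex_of_real (sqrt ((\<Prod>j<n. fact (s j)) / fact n))"
  have supp: "(valid_config n b \<and> (\<forall>p\<in>set b. snd p = 0) \<and> (\<forall>j<n. occ b j = s j)) \<longleftrightarrow> b \<in> S" for b
    using mset_indistinguishable[of n b c] c occ_mset[of b c] valid_config_mset[of b c n] mset_eq_setD[of b c]
    by (auto simp: S_def)
  have fock: "fock_state n s b = (if b \<in> S then a else 0)" for b
    unfolding supp[symmetric] fock_state_def a_def ..
  have "S \<subseteq> {b. set b \<subseteq> set c \<and> length b = length c}"
    by (auto simp: S_def dest: mset_eq_setD mset_eq_length)
  then have "finite S"
    using finite_lists_length_eq[of "set c" "length c"] by (auto intro: finite_subset)
  have "inner_v (fock_state n s) \<psi> = (\<Sum>\<^sub>\<infinity>b\<in>S. a * \<psi> c)"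
    unfolding inner_v_def
  proof (rule infsum_cong_neutral)
    fix b assume "b \<in> UNIV \<inter> S"
    then have "\<psi> b = \<psi> c" using sym unfolding S_def symmetric_v_def by blast
    then show "cnj (fock_state n s b) * \<psi> b = a * \<psi> c"
      using \<open>b \<in> UNIV \<inter> S\<close> by (simp add: fock) (simp add: a_def)
  qed (auto simp: fock)
  also have "\<dots> = (of_nat (card S) * a) * \<psi> c"
    using \<open>finite S\<close> by simp
  finally have "inner_v (fock_state n s) \<psi> = (of_nat (card S) * a) * \<psi> c" .
  moreover have "a \<noteq> 0"
    unfolding a_def by (simp add: prod_zero_iff)
  moreover have "card S \<noteq> 0"
    using \<open>finite S\<close> by (auto simp: S_def)
  ultimately show ?thesis by (metis no_zero_divisors of_nat_eq_0_iff)
qed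

lemma occ_conv_count: "occ c j = count (mset (map fst c)) j"
  by (induction c) (auto simp: occ_def)

lemma fock_state_ones:
  assumes ms: "ms \<in> mode_lists n"
  shows "fock_state n (\<lambda>_. 1) (zip ms (replicate n 0)) =
    (if distinct ms then complex_of_real (sqrt (1 / fact n)) else 0)"
proof -
  have len: "length ms = n" "set ms \<subseteq> {..<n}" using ms by (auto simp: mode_lists_def)
  have "(\<forall>j<n. count (mset ms) j = 1) \<longleftrightarrow> distinct ms"
  proof
    assume "\<forall>j<n. count (mset ms) j = 1"
    then show "distinct ms"
      using len by (auto simp: distinct_count_atmost_1 count_eq_zero_iff subset_iff)
  next
    assume d: "distinct ms"
    then have "set ms = {..<n}"
      using len by (intro card_subset_eq) (auto simp: distinct_card)
    then show "\<forall>j<n. count (mset ms) j = 1"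
      using d by (auto simp: distinct_count_atmost_1)
  qed
  moreover have "occ (zip ms (replicate n 0)) j = count (mset ms) j" for j
    using len by (simp add: occ_conv_count)
  moreover have "\<forall>p\<in>set (zip ms (replicate n (0::nat))). snd p = 0"
    by (auto dest: set_zip_rightD)
  ultimately show ?thesis
    using ms by (simp add: fock_state_def valid_config_zip)
qed

text \<open>With one input photon per mode, exactly the distinct mode lists survive. They are the
  injections of \<open>{..<n}\<close> into itself, so the amplitude is a permanent up to
  normalisation.\<close>

lemma lift_fock_state_ones:
  assumes c: "valid_config n c" "\<forall>p\<in>set c. snd p = 0"
  shows "lift n U (fock_state n (\<lambda>_. 1)) c =
    complex_of_real (sqrt (1 / fact n)) * inj_sum (\<lambda>j k. U (fst (c ! k)) j) {..<n} {..<n}"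
proof -
  have snd0: "map snd c = replicate n 0"
    using c by (auto simp: valid_config_def intro!: nth_equalityI)
  have "inj_sum (\<lambda>j k. U (fst (c ! k)) j) {..<n} {..<n} =
      (\<Sum>ms\<in>{ms\<in>mode_lists n. distinct ms}. \<Prod>k<n. U (fst (c ! k)) (ms ! k))"
    unfolding inj_sum_def
  proof (rule sum.reindex_bij_witness[where j="\<lambda>f. map f [0..<n]" and i="\<lambda>ms. restrict (\<lambda>k. ms ! k) {..<n}"], goal_cases)
    case (1 f)
    then show ?case by (auto simp: fun_eq_iff PiE_iff extensional_def)
  next
    case (2 f)
    then show ?case by (auto simp: mode_lists_def distinct_map lessThan_atLeast0 PiE_iff)
  next
    case (3 ms)
    then show ?case by (intro nth_equalityI) (auto simp: mode_listsD)
  next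
    case (4 ms)
    then show ?case by (auto simp: mode_listsD inj_on_def nth_eq_iff_index_eq)
  next
    case (5 f)
    show ?case by (intro prod.cong) auto
  qed
  also have "\<dots> = (\<Sum>ms\<in>mode_lists n. if distinct ms then \<Prod>k<n. U (fst (c ! k)) (ms ! k) else 0)"
    by (rule sum.inter_filter) simp
  finally show ?thesis
    unfolding lift_eq(1)[OF c(1)] snd0 sum_distrib_left
    by (auto simp: fock_state_ones sum_distrib_left simp del: One_nat_def intro!: sum.cong)
qed

text \<open>A sum of character values is \<open>n\<close> or 0 according to whether the character is
  trivial, and \<open>fix1\<close> makes the product of all the characters trivial. So
  \<open>inj_sum_nonzero\<close> applies to \<open>U\<close>, rescaled to have ones in column
  0.\<close>

lemma lift_fock_state_ones_nonzero:
  fixes p k :: nat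
  assumes n: "n = p ^ k" "prime p" "0 < k"
    and perm: "\<And>\<sigma>. \<sigma> \<in> G \<Longrightarrow> \<sigma> permutes {..<n}"
    and trans: "\<And>j. j < n \<Longrightarrow> \<exists>\<sigma>\<in>G. \<sigma> 0 = j"
    and U: "\<And>\<sigma>. \<sigma> \<in> G \<Longrightarrow> intertwines n U \<sigma> (d \<sigma>)"
    and U0: "u \<noteq> 0" "\<And>i. i < n \<Longrightarrow> U i 0 = u"
    and c: "valid_config n c" "\<forall>p\<in>set c. snd p = 0"
    and fix1: "\<And>\<sigma>. \<sigma> \<in> G \<Longrightarrow> (\<Prod>j<n. d \<sigma> j ^ occ c j) = 1"
  shows "lift n U (fock_state n (\<lambda>_. 1)) c \<noteq> 0"
proof -
  \<comment> \<open>The entry \<open>K j i\<close> is the value \<open>d \<sigma> (fst (c ! i))\<close> of a character of \<open>G\<close> at the \<open>\<sigma>\<close> with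
    \<open>\<sigma> 0 = j\<close>, so that \<open>S B\<close> is a sum of character values.\<close>
  define K where "K j i = U (fst (c ! i)) j / u" for j i
  define S where "S B = (\<Sum>j<n. \<Prod>i\<in>B. K j i)" for B
  have n0: "0 < n" using n by (simp add: prime_gt_0_nat)
  have K_shift: "K (\<sigma> j) i = d \<sigma> (fst (c ! i)) * K j i" if "\<sigma> \<in> G" "j < n" "i < n" for \<sigma> j i
    using U[OF that(1)] that valid_configD(2)[OF c(1)] by (simp add: intertwines_def K_def)
  have K_0: "K 0 i = 1" if "i < n" for i
    using U0 valid_configD(2)[OF c(1) that] by (simp add: K_def)
  have S_one: "S B = of_nat n"
    if "B \<subseteq> {..<n}" "\<And>\<sigma>. \<sigma> \<in> G \<Longrightarrow> (\<Prod>i\<in>B. d \<sigma> (fst (c ! i))) = 1" for B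
  proof -
    have "(\<Prod>i\<in>B. K j i) = 1" if j: "j < n" for j
    proof -
      obtain \<sigma> where \<sigma>: "\<sigma> \<in> G" "\<sigma> 0 = j" using trans[OF j] by blast
      \<comment> \<open>At index 0 every \<open>K 0 i\<close> is 1, so the shift by \<sigma> leaves
        just the eigenvalues.\<close>
      have "(\<Prod>i\<in>B. K (\<sigma> 0) i) = (\<Prod>i\<in>B. d \<sigma> (fst (c ! i)))"
        using K_shift[OF \<sigma>(1) n0] K_0 \<open>B \<subseteq> {..<n}\<close> by (intro prod.cong) auto
      then show ?thesis using that \<sigma> by (simp add: \<open>\<And>\<sigma>. \<sigma> \<in> G \<Longrightarrow> (\<Prod>i\<in>B. d \<sigma> (fst (c ! i))) = 1\<close>)
    qed
    then show ?thesis by (simp add: S_def)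
  qed
  have S_cases: "S B \<in> {0, of_nat (p ^ k)}" if B: "B \<subseteq> {..<n}" for B
  proof (cases "S B = 0")
    case False
    have "(\<Prod>i\<in>B. d \<sigma> (fst (c ! i))) = 1" if \<sigma>: "\<sigma> \<in> G" for \<sigma>
    proof -
      \<comment> \<open>Permuting the summation index by \<sigma> multiplies \<open>S B\<close> by
        the product of the eigenvalues, which must be 1 as \<open>S B\<close> is nonzero.\<close>
      have "S B = (\<Sum>j<n. \<Prod>i\<in>B. K (\<sigma> j) i)"
        unfolding S_def using sum.permute[OF perm[OF \<sigma>], of "\<lambda>j. \<Prod>i\<in>B. K j i"] by (simp add: o_def)
      also have "\<dots> = (\<Prod>i\<in>B. d \<sigma> (fst (c ! i))) * S B"
        unfolding S_def sum_distrib_left prod.distrib[symmetric]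
        using K_shift[OF \<sigma>] B by (intro sum.cong prod.cong) auto
      finally show ?thesis using False by simp
    qed
    then have "S B = of_nat n" using S_one[OF B] by blast
    then show ?thesis using n by simp
  qed simp
  have "(\<Prod>i<n. d \<sigma> (fst (c ! i))) = 1" if "\<sigma> \<in> G" for \<sigma>
    using fix1[OF that] prod_modes_occ[OF c(1), of "d \<sigma>"] by simp
  then have "S {..<n} = of_nat n" using S_one by blast
  then have "inj_sum K {..<n} {..<n} \<noteq> 0"
    using n0 n S_cases by (intro inj_sum_nonzero[OF n(2,3)]) (auto simp: S_def)
  moreover have "inj_sum K {..<n} {..<n} = inj_sum (\<lambda>j k. U (fst (c ! k)) j) {..<n} {..<n} / u ^ n"
    unfolding inj_sum_def K_def by (simp add: prod_dividef sum_divide_distrib)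
  ultimately show ?thesis
    by (simp add: lift_fock_state_ones[OF c] del: One_nat_def)
qed

section \<open>Ideal patterns and the invariance condition\<close>

lemma occ_relabel:
  assumes "inj \<sigma>"
  shows "occ (relabel \<sigma> c) (\<sigma> j) = occ c j"
  by (induction c) (auto simp: occ_def relabel_def inj_eq[OF assms])

lemma fock_state_ones_relabel:
  assumes "\<sigma> permutes {..<n}" "valid_config n c"
  shows "fock_state n (\<lambda>_. 1) (relabel \<sigma> c) = fock_state n (\<lambda>_. 1) c"
proof -
  have "(\<forall>j<n. occ (relabel \<sigma> c) j = 1) \<longleftrightarrow> (\<forall>j\<in>\<sigma> ` {..<n}. occ (relabel \<sigma> c) j = 1)"
    by (simp only: permutes_image[OF assms(1)] Ball_def lessThan_iff)
  also have "\<dots> \<longleftrightarrow> (\<forall>j<n. occ c j = 1)"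
    by (auto simp: occ_relabel permutes_inj[OF assms(1)])
  finally have "(\<forall>j<n. occ (relabel \<sigma> c) j = 1) \<longleftrightarrow> (\<forall>j<n. occ c j = 1)" .
  moreover have "(\<forall>p\<in>set (relabel \<sigma> c). snd p = 0) \<longleftrightarrow> (\<forall>p\<in>set c. snd p = 0)"
    by (auto simp: relabel_def)
  ultimately show ?thesis
    using assms by (simp add: fock_state_def valid_config_relabel del: One_nat_def)
qed

text \<open>A nonzero amplitude has a nonzero coordinate of pattern \<open>s\<close>. The all-ones
  input is invariant under relabelling, so \<open>lift_intertwines\<close> forces the factor there
  to be 1.\<close>

lemma ideal_pattern_invariant:
  assumes \<sigma>: "\<sigma> permutes {..<n}" and U: "intertwines n U \<sigma> e" and ideal: "ideal_pattern n U s"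
  shows "(\<Prod>j<n. e j ^ s j) = 1"
proof -
  let ?\<psi> = "lift n U (fock_state n (\<lambda>_. 1))"
  have "\<exists>c. cnj (fock_state n s c) * ?\<psi> c \<noteq> 0"
  proof (rule ccontr)
    assume "\<not> ?thesis"
    then have "inner_v (fock_state n s) ?\<psi> = 0"
      unfolding inner_v_def by (intro infsum_0) auto
    then show False using ideal by (simp add: ideal_pattern_def)
  qed
  then obtain c where c: "fock_state n s c \<noteq> 0" "?\<psi> c \<noteq> 0" by auto
  then have v: "valid_config n c" "\<forall>j<n. occ c j = s j"
    by (auto simp: fock_state_def split: if_splits)
  have "?\<psi> c = (\<Prod>j<n. e j ^ occ c j) * ?\<psi> c"
    using lift_intertwines[where \<psi>="fock_state n (\<lambda>_. 1)", OF \<sigma> U _ v(1)]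
      fock_state_ones_relabel[OF \<sigma>] by blast
  with c v show ?thesis by simp
qed

text \<open>Converse of \<open>ideal_pattern_invariant\<close> for prime powers \<open>n\<close> and
  patterns with one photon in mode 0.\<close>

lemma ideal_pattern_occ:
  fixes p k :: nat
  assumes n: "n = p ^ k" "prime p" "0 < k"
    and perm: "\<And>\<sigma>. \<sigma> \<in> G \<Longrightarrow> \<sigma> permutes {..<n}"
    and trans: "\<And>j. j < n \<Longrightarrow> \<exists>\<sigma>\<in>G. \<sigma> 0 = j"
    and U: "\<And>\<sigma>. \<sigma> \<in> G \<Longrightarrow> intertwines n U \<sigma> (d \<sigma>)"
    and U0: "u \<noteq> 0" "\<And>i. i < n \<Longrightarrow> U i 0 = u"
    and c: "valid_config n c" "occ c 0 = 1" and s: "\<forall>j<n. occ c j = s j"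
    and fix1: "\<And>\<sigma>. \<sigma> \<in> G \<Longrightarrow> (\<Prod>j<n. d \<sigma> j ^ occ c j) = 1"
  shows "ideal_pattern n U s"
proof -
  \<comment> \<open>\<open>b\<close> forgets the internal states: ideal patterns refer to
    indistinguishable photons, while \<open>c\<close> may carry any internal indices.\<close>
  define b where "b = map (\<lambda>p. (fst p, 0::nat)) c"
  have occ: "occ b j = occ c j" for j
    by (simp add: occ_conv_count b_def o_def)
  have b: "valid_config n b" "\<forall>p\<in>set b. snd p = 0"
    using c by (auto simp: valid_config_def b_def)
  have "lift n U (fock_state n (\<lambda>_. 1)) b \<noteq> 0"
    by (rule lift_fock_state_ones_nonzero[OF n perm trans U U0 b]) (auto simp: occ fix1)
  moreover obtain a where "a \<noteq> 0"
    "inner_v (fock_state n s) (lift n U (fock_state n (\<lambda>_. 1))) = a * lift n U (fock_state n (\<lambda>_. 1)) b"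
    using inner_fock_state[OF lift_symmetric[OF fock_state_symmetric] b] s occ by metis
  moreover have "0 < n" using n by (simp add: prime_gt_0_nat)
  ultimately show ?thesis
    using sum_occ[OF c(1)] s c(2) by (auto simp: ideal_pattern_def)
qed

section \<open>Heralding\<close>

lemma normsq_proj_occ:
  "normsq_v (proj_occ n s \<psi>) = (\<Sum>\<^sub>\<infinity>c\<in>{c. \<forall>j<n. occ c j = s j}. (cmod (\<psi> c))\<^sup>2)"
  unfolding normsq_v_def by (rule infsum_cong_neutral) (auto simp: proj_occ_def)

lemma finite_patterns: "finite (patterns n)"
proof (rule finite_subset)
  show "finite {s. \<forall>i. (i \<in> {..<n} \<longrightarrow> s i \<in> {..n}) \<and> (i \<notin> {..<n} \<longrightarrow> s i = 0)}"
    by (rule finite_set_of_finite_funs) auto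
  have "s i \<le> n" if "s \<in> patterns n" "i < n" for s :: "nat \<Rightarrow> nat" and i
    using that member_le_sum[of i "{..<n}" s] by (auto simp: patterns_def)
  then show "patterns n \<subseteq> {s. \<forall>i. (i \<in> {..<n} \<longrightarrow> s i \<in> {..n}) \<and> (i \<notin> {..<n} \<longrightarrow> s i = 0)}"
    by (auto simp: patterns_def)
qed

text \<open>Every ideal pattern has one photon in mode 0, and \<open>ideal\<close> makes every such
  pattern that meets the support of \<psi> ideal. Both sides therefore sum over the same nonzero
  coordinates.\<close>

lemma herald_eq_one_photon:
  assumes summable: "(\<lambda>c. (cmod (\<psi> c))\<^sup>2) summable_on UNIV" and valid: "\<And>c. \<psi> c \<noteq> 0 \<Longrightarrow> valid_config n c"
    and n: "0 < n"
    and ideal: "\<And>c s. \<psi> c \<noteq> 0 \<Longrightarrow> occ c 0 = 1 \<Longrightarrow> \<forall>j<n. occ c j = s j \<Longrightarrow> ideal_pattern n U s"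
  shows "(\<Sum>s\<in>{s\<in>patterns n. ideal_pattern n U s}. normsq_v (proj_occ n s \<psi>)) = normsq_v (proj_one0 \<psi>)"
proof -
  let ?I = "{s\<in>patterns n. ideal_pattern n U s}" and ?B = "\<lambda>s. {c. \<forall>j<n. occ c j = s j}"
  have "(\<Sum>s\<in>?I. normsq_v (proj_occ n s \<psi>)) = (\<Sum>\<^sub>\<infinity>c\<in>(\<Union>s\<in>?I. ?B s). (cmod (\<psi> c))\<^sup>2)"
    unfolding normsq_proj_occ
  proof (rule sum_infsum)
    show "finite ?I" using finite_patterns[of n] by simp
    show "(\<lambda>c. (cmod (\<psi> c))\<^sup>2) summable_on ?B s" for s
      using summable by (rule summable_on_subset_banach) simp
    fix s s' assume s: "s \<in> ?I" "s' \<in> ?I" "s \<noteq> s'"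
    \<comment> \<open>Patterns are 0 from \<open>n\<close> on, so two different ones already differ
      at some mode below \<open>n\<close>.\<close>
    then obtain j where "s j \<noteq> s' j" by (auto simp: fun_eq_iff)
    then have "j < n" using s by (cases "j < n") (auto simp: patterns_def)
    with \<open>s j \<noteq> s' j\<close> show "?B s \<inter> ?B s' = {}" by auto
  qed
  also have "\<dots> = normsq_v (proj_one0 \<psi>)"
    unfolding normsq_v_def
  proof (rule infsum_cong_neutral)
    fix c assume c: "c \<in> UNIV - (\<Union>s\<in>?I. ?B s)"
    show "(cmod (proj_one0 \<psi> c))\<^sup>2 = 0"
    proof (rule ccontr)
      assume "(cmod (proj_one0 \<psi> c))\<^sup>2 \<noteq> 0"
      then have nz: "\<psi> c \<noteq> 0" "occ c 0 = 1" by (auto simp: proj_one0_def split: if_splits)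
      define s where "s = (\<lambda>j. if j < n then occ c j else 0)"
      have "s \<in> patterns n" using sum_occ[OF valid[OF nz(1)]] by (simp add: s_def patterns_def)
      moreover have "ideal_pattern n U s" by (rule ideal[OF nz]) (simp add: s_def)
      ultimately show False using c by (auto simp: s_def)
    qed
  next
    fix c assume "c \<in> (\<Union>s\<in>?I. ?B s) \<inter> UNIV"
    then have "occ c 0 = 1" using n by (auto simp: ideal_pattern_def)
    then show "(cmod (\<psi> c))\<^sup>2 = (cmod (proj_one0 \<psi> c))\<^sup>2" by (simp add: proj_one0_def)
  qed simp
  finally show ?thesis .
qed

section \<open>Transitivity of the two groups on the modes\<close>

lemma xor_group_transitive: "j < 2 ^ r \<Longrightarrow> \<exists>\<sigma>\<in>xor_group r. \<sigma> 0 = j"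
  by (auto simp: xor_group_def intro!: exI[of _ j])

lemma cyc_funpow_zero: "k < n \<Longrightarrow> (cyc n ^^ k) 0 = k"
  by (induction k) (auto simp: cyc_def)

lemma cyc_group_transitive: "j < n \<Longrightarrow> \<exists>\<sigma>\<in>cyc_group n. \<sigma> 0 = j"
  using cyc_funpow_zero by (auto simp: cyc_group_def)

theorem theorem6:
  fixes n :: nat and U :: mat and G :: "(nat \<Rightarrow> nat) set"
    and d :: "(nat \<Rightarrow> nat) \<Rightarrow> nat \<Rightarrow> complex" and \<eta> \<phi> :: vec
  assumes U_unitary: "unitary_mat n U"
    and G_group: "abelian_perm_group n G"
    and diag: "\<forall>\<sigma>\<in>G. \<forall>i<n. \<forall>j<n. (\<Sum>k<n. U i k * perm_mat \<sigma> k j) = d \<sigma> i * U i j"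
    and eta_space: "in_space n \<eta>" and eta_sym: "symmetric_v \<eta>" and eta_norm: "normsq_v \<eta> = 1"
    and phi_proj: "is_eig_projection n G \<eta> \<phi>" and phi_nz: "\<phi> \<noteq> (\<lambda>_. 0)"
  shows
   "(\<forall>s. (\<Sum>i<n. s i) = n \<and> (\<forall>\<sigma>\<in>G. (\<Prod>i<n. d \<sigma> i ^ s i) = 1) \<longrightarrow>
        proj_occ n s (lift n U \<eta>) =
        (\<lambda>c. inner_v (normalize_v \<phi>) \<eta> * proj_occ n s (lift n U (normalize_v \<phi>)) c))
    \<and> herald n U \<eta> = (cmod (inner_v (normalize_v \<phi>) \<eta>))\<^sup>2 * herald n U (normalize_v \<phi>)
    \<and> (herald n U \<eta> \<noteq> 0 \<and> herald n U (normalize_v \<phi>) \<noteq> 0 \<longrightarrow>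
        error_rate n U \<eta> = error_rate n U (normalize_v \<phi>))
    \<and> (((\<exists>r. n = 2 ^ r \<and> n \<ge> 4 \<and> (\<forall>i<n. \<forall>j<n. U i j = hadamard_mat r i j) \<and> G = xor_group r)
         \<or> (n \<ge> 3 \<and> (\<exists>p k. prime p \<and> n = p ^ k) \<and> (\<forall>i<n. \<forall>j<n. U i j = fourier_mat n i j)
            \<and> G = cyc_group n))
       \<longrightarrow> herald n U (normalize_v \<phi>) = normsq_v (proj_one0 (lift n U (normalize_v \<phi>))))"
proof -
  define \<alpha> where "\<alpha> = inner_v (normalize_v \<phi>) \<eta>"
  let ?\<phi> = "normalize_v \<phi>"
  have perm: "\<sigma> permutes {..<n}" if "\<sigma> \<in> G" for \<sigma>
    using G_group that by (auto simp: abelian_perm_group_def)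
  have twine: "intertwines n U \<sigma> (d \<sigma>)" if \<sigma>: "\<sigma> \<in> G" for \<sigma>
    unfolding intertwines_def
  proof (intro allI impI)
    fix i j assume ij: "i < n" "j < n"
    have "\<sigma> j < n" using permutes_in_image[OF perm[OF \<sigma>]] ij by auto
    then have "(\<Sum>k<n. U i k * perm_mat \<sigma> k j) = U i (\<sigma> j)"
      by (simp add: perm_mat_def if_distrib cong: if_cong)
    then show "U i (\<sigma> j) = d \<sigma> i * U i j" using diag \<sigma> ij by simp
  qed
  have eig: "in_eig n G \<phi>" using phi_proj by (simp add: is_eig_projection_def)
  then have phi_space: "in_space n \<phi>" by (simp add: in_eig_def)
  have N: "0 < normsq_v \<phi>" by (rule normsq_pos[OF phi_space phi_nz])
  \<comment> \<open>The overlap is the norm of \<phi>, so \<phi> is \<alpha> times its own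
    normalisation; this is the factor that appears in all the claims.\<close>
  have \<alpha>: "\<alpha> = complex_of_real (sqrt (normsq_v \<phi>))"
    unfolding \<alpha>_def by (rule inner_normalized_eig_projection[OF phi_proj eta_space phi_nz])
  then have "\<alpha> \<noteq> 0" using N by simp
  have normalized: "?\<phi> = (\<lambda>c. inverse \<alpha> * \<phi> c)"
    by (simp add: normalize_v_def \<alpha> divide_inverse mult.commute)
  then have "\<phi> = (\<lambda>c. \<alpha> * ?\<phi> c)" using \<open>\<alpha> \<noteq> 0\<close> by (simp add: fun_eq_iff)
  then have lift_phi: "lift n U \<phi> c = \<alpha> * lift n U ?\<phi> c" for c
    using lift_scale[of n U \<alpha> ?\<phi>] by metis
  have lift_eta: "lift n U \<eta> c = \<alpha> * lift n U ?\<phi> c"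
    if "\<forall>j<n. occ c j = s j" "\<forall>\<sigma>\<in>G. (\<Prod>i<n. d \<sigma> i ^ s i) = 1" for c s
    using lift_eig_projection[OF perm twine phi_proj, of c] that by (simp add: lift_phi)
  have part1: "proj_occ n s (lift n U \<eta>) = (\<lambda>c. \<alpha> * proj_occ n s (lift n U ?\<phi>) c)"
    if "\<forall>\<sigma>\<in>G. (\<Prod>i<n. d \<sigma> i ^ s i) = 1" for s
    using lift_eta that by (auto simp: proj_occ_def fun_eq_iff)
  \<comment> \<open>Ideal patterns satisfy the invariance condition, so the coordinate identity
    covers every term of the heralding rate and of the error rate.\<close>
  have ideal: "\<forall>\<sigma>\<in>G. (\<Prod>i<n. d \<sigma> i ^ s i) = 1" if "ideal_pattern n U s" for s
    using ideal_pattern_invariant[OF perm twine that] by blast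
  have herald: "herald n U \<eta> = (cmod \<alpha>)\<^sup>2 * herald n U ?\<phi>"
  proof -
    have "normsq_v (proj_occ n s (lift n U \<eta>)) = (cmod \<alpha>)\<^sup>2 * normsq_v (proj_occ n s (lift n U ?\<phi>))"
      if "ideal_pattern n U s" for s
      unfolding part1[OF ideal[OF that]] normsq_v_def norm_mult power_mult_distrib
      by (rule infsum_cmult_right')
    then show ?thesis by (simp add: herald_def sum_distrib_left)
  qed
  have error: "error_rate n U \<eta> = error_rate n U ?\<phi>"
  proof -
    have "inner_v (fock_basis n M) (lift n U \<eta>) = \<alpha> * inner_v (fock_basis n M) (lift n U ?\<phi>)"
      if M: "M \<in> error_outcomes n U" for M
      unfolding inner_v_def infsum_cmult_right'[symmetric]
    proof (rule infsum_cong)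
      fix c :: config
      \<comment> \<open>Every configuration in the support of the basis state of \<open>M\<close>
        has the pattern of \<open>M\<close>, which is ideal.\<close>
      have "lift n U \<eta> c = \<alpha> * lift n U ?\<phi> c" if "fock_basis n M c \<noteq> 0"
      proof (rule lift_eta)
        have "mset c = M" using that by (auto simp: fock_basis_def split: if_splits)
        then show "\<forall>j<n. occ c j = (if j < n then mocc M j else 0)"
          by (auto simp: occ_def mocc_def simp flip: mset_filter)
        show "\<forall>\<sigma>\<in>G. (\<Prod>i<n. d \<sigma> i ^ (if i < n then mocc M i else 0)) = 1"
          using M by (intro ideal) (simp add: error_outcomes_def)
      qed
      then show "cnj (fock_basis n M c) * lift n U \<eta> c = \<alpha> * (cnj (fock_basis n M c) * lift n U ?\<phi> c)"
        by (cases "fock_basis n M c = 0") auto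
    qed
    then have "(\<Sum>\<^sub>\<infinity>M\<in>error_outcomes n U. (cmod (inner_v (fock_basis n M) (lift n U \<eta>)))\<^sup>2) =
        (\<Sum>\<^sub>\<infinity>M\<in>error_outcomes n U. (cmod \<alpha>)\<^sup>2 * (cmod (inner_v (fock_basis n M) (lift n U ?\<phi>)))\<^sup>2)"
      by (intro infsum_cong) (simp add: norm_mult power_mult_distrib)
    \<comment> \<open>The nonzero factor \<open>(cmod \<alpha>)\<^sup>2\<close> cancels between the
      error sum and the heralding rate.\<close>
    then show ?thesis
      using \<open>\<alpha> \<noteq> 0\<close> by (simp add: error_rate_def herald infsum_cmult_right')
  qed
  \<comment> \<open>Both matrix families enter only through a prime power \<open>n\<close>, a
    transitive group and a constant column 0 of \<open>U\<close>.\<close>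
  have part3: "herald n U ?\<phi> = normsq_v (proj_one0 (lift n U ?\<phi>))"
    if n: "n = p ^ k" "prime p" "0 < k" and trans: "\<And>j. j < n \<Longrightarrow> \<exists>\<sigma>\<in>G. \<sigma> 0 = j"
      and U0: "u \<noteq> 0" "\<And>i. i < n \<Longrightarrow> U i 0 = u" for p k :: nat and u
    unfolding herald_def
  proof (rule herald_eq_one_photon)
    have "(\<lambda>c. (cmod (\<phi> c))\<^sup>2) summable_on UNIV" using phi_space by (simp add: in_space_def)
    then have "(\<lambda>c. (cmod (inverse \<alpha>))\<^sup>2 * (cmod (\<phi> c))\<^sup>2) summable_on UNIV"
      by (rule summable_on_cmult_right)
    then have "in_space n ?\<phi>"
      using phi_space by (simp add: in_space_def normalized norm_mult power_mult_distrib)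
    then show "(\<lambda>c. (cmod (lift n U ?\<phi> c))\<^sup>2) summable_on UNIV"
      by (rule lift_square_summable)
    show "0 < n" using n by (simp add: prime_gt_0_nat)
    show "valid_config n c" if "lift n U ?\<phi> c \<noteq> 0" for c
      using that by (metis lift_eq(2))
    fix c s assume c: "lift n U ?\<phi> c \<noteq> 0" "occ c 0 = 1" and s: "\<forall>j<n. occ c j = s j"
    have valid: "valid_config n c" using c by (metis lift_eq(2))
    \<comment> \<open>Invariance of the normalised \<phi> confines its image under \<open>U\<close>
      to the coordinates that satisfy the condition.\<close>
    have "(\<Prod>j<n. d \<sigma> j ^ occ c j) = 1" if "\<sigma> \<in> G" for \<sigma>
    proof -
      have "?\<phi> (relabel \<sigma> b) = ?\<phi> b" if "valid_config n b" for b
        using in_eig_relabel[OF eig \<open>\<sigma> \<in> G\<close> perm[OF \<open>\<sigma> \<in> G\<close>] that] by (simp add: normalize_v_def)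
      then have "lift n U ?\<phi> c = (\<Prod>j<n. d \<sigma> j ^ occ c j) * lift n U ?\<phi> c"
        using lift_intertwines[where \<psi>="?\<phi>", OF perm[OF that] twine[OF that] _ valid] by blast
      with c show ?thesis by simp
    qed
    then show "ideal_pattern n U s"
      using ideal_pattern_occ[OF n perm trans twine U0 valid c(2) s] by blast
  qed
  have hadamard: "herald n U ?\<phi> = normsq_v (proj_one0 (lift n U ?\<phi>))"
    if r: "n = 2 ^ r" "n \<ge> 4" "\<forall>i<n. \<forall>j<n. U i j = hadamard_mat r i j" "G = xor_group r" for r
  proof (rule part3)
    \<comment> \<open>\<open>n \<ge> 4\<close> excludes the exponent 0; the prime is 2 here.\<close>
    show "0 < r" using r by (cases r) auto
    show "\<exists>\<sigma>\<in>G. \<sigma> 0 = j" if "j < n" for j using xor_group_transitive r that by simp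
    show "U i 0 = complex_of_real (1 / sqrt (2 ^ r))" if "i < n" for i
      using r that by (simp add: hadamard_mat_def)
  qed (use r in auto)
  have fourier: "herald n U ?\<phi> = normsq_v (proj_one0 (lift n U ?\<phi>))"
    if F: "n \<ge> 3" "prime p" "n = p ^ k" "\<forall>i<n. \<forall>j<n. U i j = fourier_mat n i j" "G = cyc_group n" for p k :: nat
  proof (rule part3)
    \<comment> \<open>Likewise \<open>n \<ge> 3\<close> excludes the prime power
      \<open>p ^ 0\<close>.\<close>
    show "0 < k" using F by (cases k) auto
    show "\<exists>\<sigma>\<in>G. \<sigma> 0 = j" if "j < n" for j using cyc_group_transitive F that by simp
    show "U i 0 = 1 / complex_of_real (sqrt (real n))" if "i < n" for i
    proof -
      have "0 < n" using F(1) by simp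
      then have "U i 0 = fourier_mat n i 0" using F(4) that by blast
      then show ?thesis by (simp add: fourier_mat_def)
    qed
  qed (use F in auto)
  show ?thesis
    using part1 herald error hadamard fourier unfolding \<alpha>_def by blast
qed

end
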